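(* Let $n$ be a nonnegative integer. (i) The integer $a_{2n+1}$ is the number of solutions of the equation $$\sum_{k=-n}^{n} k\,\epsilon_k=0,$$ where $\epsilon_k\in\{0,1\}$ for $-n\le k\le n$. In other words, $a_{2n+1}$ is the number of ways that a sum of integers between $-n$ and $n$ (with no repetitions) equals $0$. (ii) The integer $a_{2n}$ is the number of solutions of $$\sum_{k=-n+1}^{n} (2k-1)\,\epsilon_k=0\ \text{ or }\ 1,$$ where $\epsilon_k\in\{0,1\}$ for $-n+1\le k\le n$. In other words, $a_{2n}$ is the number of ways that a sum of half-integers between $-n+1/2$ and $n-1/2$ (with no repetitions) equals $0$ or $1/2$.
   Context: For $n\ge 1$ and $\theta\in\mathbb{R}$, $\mathscr{A}_{n,\theta}=\mathcal{C}(\mathbb{T}^n)\rtimes_\sigma\mathbb{Z}$ is the crossed product by the Anzai transformation $\sigma$ on $\mathbb{T}^n$, given by $\sigma^{-1}(\zeta_1,\dots,\zeta_n)=(e^{2\pi i\theta}\zeta_1,\zeta_1\zeta_2,\dots,\zeta_{n-1}\zeta_n)$, acting on $\mathcal{C}(\mathbb{T}^n)$ by $f\mapsto f\circ\sigma^{-1}$. $a_n$ denotes the common rank of $K_0(\mathscr{A}_{n,\theta})$ and $K_1(\mathscr{A}_{n,\theta})$ (independent of $\theta$); equivalently, $a_n=\sum_{r=0}^n\mathrm{rank}\ker(\wedge^r\mathsf{S}_n-\mathsf{I})$, where $\mathsf{S}_n$ is the $n\times n$ Jordan block with $1$'s on the diagonal and superdiagonal. For $n=0$ ($\mathbb{T}^0$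 a point, trivial action) one has $a_0=1$. Empty sums equal $0$ (and the empty choice of $\epsilon$'s counts as one choice). *)

theory Defs
  imports "Jordan_Normal_Form.Jordan_Normal_Form" "HOL-Library.Function_Algebras"
    "HOL-Library.FuncSet"
begin

text \<open>
  The exterior algebra of $\mathbb{Z}^n$, in coordinates: a function \<open>x :: nat set \<Rightarrow> int\<close> supported
  on subsets of \<open>{..<n}\<close> stands for the sum of all \<open>x I * e_I\<close>, where \<open>e_I\<close> is the product
  \<open>e_{i1} \<and> \<dots> \<and> e_{ir}\<close> of standard basis vectors for \<open>I = {i1 < \<dots> < ir}\<close>. Indices start
  at 0, as for the matrices of the library.
\<close>

definition ext_power :: "nat \<Rightarrow> nat \<Rightarrow> (nat set \<Rightarrow> int) set" where
  "ext_power r n = {x. \<forall>I. x I \<noteq> 0 \<longrightarrow> I \<subseteq> {..<n} \<and> card I = r}"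

definition ext_one :: "nat set \<Rightarrow> int" where
  "ext_one I = (if I = {} then 1 else 0)"

text \<open>
  Left exterior multiplication by a vector \<open>v\<close>, the bilinear extension of
  \<open>e_i \<and> e_I = 0\<close> for \<open>i \<in> I\<close> and \<open>e_i \<and> e_I = (-1)^(card {j \<in> I. j < i}) * e_(insert i I)\<close>
  for \<open>i \<notin> I\<close>.
\<close>

definition wedge :: "int vec \<Rightarrow> (nat set \<Rightarrow> int) \<Rightarrow> nat set \<Rightarrow> int" where
  "wedge v x K =
     (if K \<subseteq> {..<dim_vec v}
      then \<Sum>i\<in>K. (-1) ^ card {j\<in>K. j < i} * (v $ i) * x (K - {i})
      else 0)"

text \<open>
  The \<open>r\<close>-th exterior power of the endomorphism of $\mathbb{Z}^n$ given by the \<open>n \<times> n\<close> matrix \<open>A\<close>: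
  the linear map with \<open>e_{j1} \<and> \<dots> \<and> e_{jr} \<mapsto> A e_{j1} \<and> \<dots> \<and> A e_{jr}\<close>, where
  \<open>A e_j = col A j\<close>.
\<close>

definition ext_power_map :: "nat \<Rightarrow> int mat \<Rightarrow> (nat set \<Rightarrow> int) \<Rightarrow> nat set \<Rightarrow> int" where
  "ext_power_map r A x =
     (\<lambda>K. \<Sum>J | J \<subseteq> {..<dim_col A} \<and> card J = r.
        x J * foldr wedge (map (col A) (sorted_list_of_set J)) ext_one K)"

interpretation zmod: Modules.module "\<lambda>(c::int) (x::nat set \<Rightarrow> int) I. c * x I"
  by unfold_locales (auto simp: fun_eq_iff algebra_simps)

text \<open>
  The rank of an abelian group: the largest number of \<open>\<int>\<close>-linearly independent elements. The
  maximum exists whenever \<open>G\<close> has finite rank, in particular for the subgroups of an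
  \<open>ext_power r n\<close>.
\<close>

definition group_rank :: "(nat set \<Rightarrow> int) set \<Rightarrow> nat" where
  "group_rank G = Max {card B | B. finite B \<and> B \<subseteq> G \<and> zmod.independent B}"

text \<open>
  The common rank $a_n$ of the groups $K_0$ and $K_1$ of the crossed product
  $\mathcal{C}(\mathbb{T}^n) \rtimes_\sigma \mathbb{Z}$ of the $n$-torus by the Anzai transformation,
  through its expression as the sum over $0 \le r \le n$ of the rank of the kernel of
  $\wedge^r S_n - I$ on $\wedge^r \mathbb{Z}^n$, where $S_n$ is the integer unipotent Jordan
  block of size $n$. No operator K-theory is developed here.
\<close>

definition anzai_K_rank :: "nat \<Rightarrow> nat" where
  "anzai_K_rank n =
     (\<Sum>r\<le>n. group_rank {x \<in> ext_power r n. ext_power_map r (jordan_block n 1) x - x = 0})"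

end

theory Submission
  imports Defs
begin

text \<open>
  Grade \<open>\<and>\<^sup>r \<rat>\<^sup>n\<close> by the weight of \<open>e_I\<close>, which is the sum of \<open>2 i - (n - 1)\<close> over \<open>i \<in> I\<close>. The
  leading component of \<open>\<and>\<^sup>r S - I\<close> is the derivation \<open>D\<close> extending \<open>e_i \<mapsto> e_(i-1)\<close>; it lowers
  the weight by 2 and all other components lower it further. As the lowering operator of an
  \<open>sl_2\<close>-representation with raising operator \<open>U\<close>, adjoint to \<open>D\<close> for a suitable inner product,
  it satisfies \<open>\<bar>D x\<bar>\<^sup>2 = \<bar>U x\<bar>\<^sup>2 + w \<bar>x\<bar>\<^sup>2\<close> for \<open>x\<close> of weight \<open>w\<close>. So \<open>D\<close> is injective
  on positive weights and \<open>D U\<close> on negative weights. Looking at components of highest weight, the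
  kernel of \<open>\<and>\<^sup>r S - I\<close> is contained in the span of the \<open>e_I\<close> of weight at most 1, which
  \<open>\<and>\<^sup>r S - I\<close> maps onto the span of the \<open>e_I\<close> of weight at most \<open>-1\<close>. Hence the rank of the kernel is
  the number of \<open>I\<close> of weight 0 or 1.
\<close>

section \<open>Raising and lowering operators\<close>

text \<open>Symmetric difference with \<open>{a, Suc a}\<close>. If exactly one of the two positions
  is occupied, it moves that element to the other. As an involution on all sets it serves both
  directions.\<close>

definition flip :: "nat \<Rightarrow> nat set \<Rightarrow> nat set" where
  "flip a K = {i. (i \<in> K) \<noteq> (i = a \<or> i = Suc a)}"

text \<open>The derivation \<open>D\<close> read off at \<open>e_K\<close>: contributions come from
  the sets in which one \<open>a \<in> K\<close> is replaced by the free position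
  \<open>Suc a\<close>. The order of the factors is unchanged, so there are no signs.\<close>

definition lower :: "nat \<Rightarrow> (nat set \<Rightarrow> rat) \<Rightarrow> nat set \<Rightarrow> rat" where
  "lower n x K = (\<Sum>a<n-1. if a \<in> K \<and> Suc a \<notin> K then x (flip a K) else 0)"

text \<open>The derivation extending \<open>e_a \<mapsto> (a + 1) * (n - 1 - a) * e_(a+1)\<close>:
  the raising operator of the \<open>n\<close>-dimensional irreducible
  \<open>sl_2\<close>-representation, in the basis where the lowering operator has coefficients
  1.\<close>

definition raise :: "nat \<Rightarrow> (nat set \<Rightarrow> rat) \<Rightarrow> nat set \<Rightarrow> rat" where
  "raise n x K = (\<Sum>a<n-1. if a \<notin> K \<and> Suc a \<in> K
     then of_nat (Suc a * (n - Suc a)) * x (flip a K) else 0)"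

definition wt :: "nat \<Rightarrow> nat set \<Rightarrow> int" where
  "wt n K = (\<Sum>i\<in>K. 2 * int i + 1 - int n)"

text \<open>The weights \<open>gram n K\<close> are chosen to make \<open>raise\<close> the adjoint of \<open>lower\<close>.\<close>

definition gram :: "nat \<Rightarrow> nat set \<Rightarrow> rat" where
  "gram n K = (\<Prod>i\<in>K. \<Prod>b<i. 1 / of_nat (Suc b * (n - Suc b)))"

definition ip :: "nat \<Rightarrow> (nat set \<Rightarrow> rat) \<Rightarrow> (nat set \<Rightarrow> rat) \<Rightarrow> rat" where
  "ip n x y = (\<Sum>K\<in>Pow {..<n}. gram n K * x K * y K)"

lemma flip_flip [simp]: "flip a (flip a K) = K"
  by (auto simp: flip_def)

lemma mem_flip [simp]: "i \<in> flip a K \<longleftrightarrow> (i \<in> K) \<noteq> (i = a \<or> i = Suc a)"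
  by (auto simp: flip_def)

lemma flip_commute: "flip a (flip b K) = flip b (flip a K)"
  by (auto simp: flip_def)

lemma flip_subset: "K \<subseteq> {..<n} \<Longrightarrow> a < n - 1 \<Longrightarrow> flip a K \<subseteq> {..<n}"
  by (auto simp: flip_def)

lemma flip_down: "a \<in> K \<Longrightarrow> Suc a \<notin> K \<Longrightarrow> flip a K = insert (Suc a) (K - {a})"
  by (auto simp: flip_def)

lemma flip_up: "a \<notin> K \<Longrightarrow> Suc a \<in> K \<Longrightarrow> flip a K = insert a (K - {Suc a})"
  by (auto simp: flip_def)

lemma flip_remove: "j \<noteq> a \<Longrightarrow> j \<noteq> Suc a \<Longrightarrow> flip a (K - {j}) = flip a K - {j}"
  by (auto simp: flip_def)

lemma gram_pos: "K \<subseteq> {..<n} \<Longrightarrow> gram n K > 0"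
  unfolding gram_def by (intro prod_pos ballI) (auto simp only: zero_less_divide_1_iff of_nat_0_less_iff nat_0_less_mult_iff zero_less_Suc subset_iff lessThan_iff zero_less_diff simp_thms)

text \<open>Moving \<open>a\<close> to \<open>Suc a\<close> lengthens one inner product by the
  factor with \<open>b = a\<close>, the reciprocal of the coefficient in \<open>raise\<close>. The
  bound on \<open>a\<close> makes this coefficient nonzero.\<close>

lemma gram_flip:
  assumes "finite K" "a < n - 1" "a \<in> K" "Suc a \<notin> K"
  shows "gram n K = of_nat (Suc a * (n - Suc a)) * gram n (flip a K)"
proof -
  have "gram n K = (\<Prod>b<a. 1 / of_nat (Suc b * (n - Suc b))) * gram n (K - {a})"
    unfolding gram_def using assms by (subst prod.remove[of K a]) auto
  moreover have "gram n (flip a K) = (\<Prod>b<Suc a. 1 / of_nat (Suc b * (n - Suc b))) * gram n (K - {a})"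
    unfolding gram_def flip_down[OF assms(3,4)] using assms by (subst prod.insert) auto
  moreover have "of_nat (Suc a * (n - Suc a)) \<noteq> (0::rat)"
    using assms(2) unfolding of_nat_eq_0_iff by simp
  ultimately show ?thesis by (simp del: of_nat_mult of_nat_Suc)
qed

lemma ip_commute: "ip n x y = ip n y x"
  by (simp add: ip_def mult.commute mult.left_commute)

text \<open>For each \<open>a\<close>, reindexing by \<open>flip a\<close> exchanges the sets that
  contribute to \<open>lower\<close> with those that contribute to \<open>raise\<close>;
  \<open>gram_flip\<close> accounts for the change of weights.\<close>

lemma ip_lower: "ip n (lower n x) y = ip n x (raise n y)"
proof -
  have *: "(\<Sum>K\<in>Pow {..<n}. gram n K * (if a \<in> K \<and> Suc a \<notin> K then x (flip a K) else 0) * y K)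
    = (\<Sum>K\<in>Pow {..<n}. gram n K * x K * (if a \<notin> K \<and> Suc a \<in> K
         then of_nat (Suc a * (n - Suc a)) * y (flip a K) else 0))" if a: "a < n - 1" for a
  proof (rule sum.reindex_bij_witness[where i="flip a" and j="flip a"], goal_cases)
    case (5 K)
    then have "finite K" using finite_subset by auto
    show ?case
      using gram_flip[OF \<open>finite K\<close> a] by (auto simp del: of_nat_mult of_nat_Suc)
  qed (use a in \<open>auto simp: flip_subset simp del: mem_flip\<close>)
  have "ip n (lower n x) y = (\<Sum>a<n-1. \<Sum>K\<in>Pow {..<n}.
      gram n K * (if a \<in> K \<and> Suc a \<notin> K then x (flip a K) else 0) * y K)"
    unfolding ip_def lower_def sum_distrib_left sum_distrib_right by (rule sum.swap)
  also have "\<dots> = (\<Sum>a<n-1. \<Sum>K\<in>Pow {..<n}. gram n K * x K * (if a \<notin> K \<and> Suc a \<in> K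
         then of_nat (Suc a * (n - Suc a)) * y (flip a K) else 0))"
    by (rule sum.cong[OF refl]) (rule *, simp)
  also have "\<dots> = ip n x (raise n y)"
    unfolding ip_def raise_def sum_distrib_left by (rule sum.swap)
  finally show ?thesis .
qed

text \<open>The diagonal part of the commutator of \<open>raise\<close> and \<open>lower\<close>.
  Summation by parts applies: \<open>p a = a * (n - a)\<close> vanishes at \<open>0\<close> and
  \<open>n\<close>, and its differences are \<open>n - 1 - 2 * a\<close>.\<close>

lemma sum_wt:
  assumes "K \<subseteq> {..<n}"
  shows "(\<Sum>a<n-1. int (Suc a * (n - Suc a)) * (of_bool (a \<in> K) - of_bool (Suc a \<in> K))) = - wt n K"
proof (cases n)
  case 0
  then show ?thesis using assms by (simp add: wt_def)
next
  case (Suc m)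
  define p where "p a = int (a * (n - a))" for a
  define e where "e a = (of_bool (a \<in> K) :: int)" for a
  have "(\<Sum>a<m. p (Suc a) * e (Suc a)) = (\<Sum>a<n. p a * e a)"
    unfolding Suc by (subst sum.lessThan_Suc_shift) (simp add: p_def)
  moreover have "(\<Sum>a<m. p (Suc a) * e a) = (\<Sum>a<n. p (Suc a) * e a)"
    unfolding Suc sum.lessThan_Suc by (simp add: p_def Suc)
  ultimately have "(\<Sum>a<n-1. p (Suc a) * (e a - e (Suc a))) = (\<Sum>a<n. (p (Suc a) - p a) * e a)"
    by (simp add: Suc algebra_simps sum_subtractf)
  also have "\<dots> = (\<Sum>a<n. if a \<in> K then int n - 1 - 2 * int a else 0)"
  proof (intro sum.cong refl)
    fix a assume "a \<in> {..<n}"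
    then obtain d where d: "n = Suc (a + d)" using less_imp_Suc_add by auto
    have "n - Suc a = d" "n - a = Suc d" by (simp_all add: d)
    then have "p (Suc a) - p a = int n - 1 - 2 * int a" by (simp add: p_def d algebra_simps)
    then show "(p (Suc a) - p a) * e a = (if a \<in> K then int n - 1 - 2 * int a else 0)"
      by (simp add: e_def)
  qed
  also have "\<dots> = (\<Sum>a\<in>K. int n - 1 - 2 * int a)"
    using assms by (subst sum.inter_restrict[symmetric]) (auto simp: Int_absorb1)
  also have "\<dots> = - wt n K" unfolding wt_def sum_negf[symmetric] by (intro sum.cong) auto
  finally show ?thesis by (simp add: p_def e_def)
qed

lemma lower_raise_commutator:
  assumes "K \<subseteq> {..<n}"
  shows "raise n (lower n x) K = lower n (raise n x) K + of_int (wt n K) * x K"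
proof -
  define p where "p a = (of_nat (Suc a * (n - Suc a)) :: rat)" for a
  let ?U = "\<lambda>a b. if b \<in> K \<and> Suc b \<notin> K \<and> a \<notin> flip b K \<and> Suc a \<in> flip b K
    then p a * x (flip a (flip b K)) else 0"
  let ?V = "\<lambda>a b. if a \<notin> K \<and> Suc a \<in> K \<and> b \<in> flip a K \<and> Suc b \<notin> flip a K
    then p a * x (flip b (flip a K)) else 0"
  let ?c = "\<lambda>a. of_bool (a \<in> K) - of_bool (Suc a \<in> K) :: rat"
  \<comment> \<open>Moves at distant positions commute. For adjacent \<open>a\<close> and
    \<open>b\<close> the conditions on both sides are contradictory, so both terms vanish. Only
    \<open>a = b\<close> leaves a difference, a multiple of \<open>x K\<close>.\<close>
  have UV: "?U a b = ?V a b + (if a = b then p a * ?c a * x K else 0)" for a b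
    by (cases "a = b"; cases "Suc a = b"; cases "Suc b = a") (auto simp: flip_commute)
  have "lower n (raise n x) K = (\<Sum>b<n-1. \<Sum>a<n-1. ?U a b)"
    unfolding lower_def raise_def p_def[symmetric] by (intro sum.cong refl) auto
  also have "\<dots> = (\<Sum>a<n-1. \<Sum>b<n-1. ?U a b)" by (rule sum.swap)
  also have "\<dots> = (\<Sum>a<n-1. \<Sum>b<n-1. ?V a b) + (\<Sum>a<n-1. p a * ?c a * x K)"
    unfolding UV sum.distrib by simp
  also have "(\<Sum>a<n-1. \<Sum>b<n-1. ?V a b) = raise n (lower n x) K"
    unfolding lower_def raise_def p_def[symmetric] sum_distrib_left
    by (intro sum.cong refl) (auto simp: sum_distrib_left intro!: sum.cong)
  also have "(\<Sum>a<n-1. p a * ?c a * x K) = of_int (- wt n K) * x K"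
    unfolding sum_wt[OF assms, symmetric] sum_distrib_right[symmetric]
    by (simp add: p_def)
  finally show ?thesis by simp
qed

text \<open>Adjointness combined with the commutator. The middle term is kept as
  \<open>\<langle>x, D U x\<rangle>\<close>: it is a square norm when injectivity of
  \<open>D\<close> is shown, and it vanishes when injectivity of \<open>D U\<close> is
  shown.\<close>

lemma ip_lower_lower:
  "ip n (lower n x) (lower n x) = ip n x (lower n (raise n x)) + (\<Sum>K\<in>Pow {..<n}. gram n K * of_int (wt n K) * (x K)\<^sup>2)"
proof -
  have "ip n (lower n x) (lower n x) = ip n x (raise n (lower n x))" by (rule ip_lower)
  also have "\<dots> = (\<Sum>K\<in>Pow {..<n}. gram n K * x K * (lower n (raise n x) K + of_int (wt n K) * x K))"
    unfolding ip_def by (intro sum.cong refl) (simp add: lower_raise_commutator)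
  also have "\<dots> = ip n x (lower n (raise n x)) + (\<Sum>K\<in>Pow {..<n}. gram n K * of_int (wt n K) * (x K)\<^sup>2)"
    unfolding ip_def by (simp add: algebra_simps sum.distrib power2_eq_square)
  finally show ?thesis .
qed

lemma ip_nonneg: "ip n x x \<ge> 0"
  unfolding ip_def by (intro sum_nonneg) (auto simp: mult.assoc gram_pos less_imp_le)

text \<open>With \<open>D x = 0\<close> the identity says that the square norm of \<open>U x\<close>
  plus a sum of nonnegative terms is zero; each term with \<open>x K \<noteq> 0\<close> would be
  positive.\<close>

lemma lower_eq_0D:
  assumes x: "\<And>K. K \<subseteq> {..<n} \<Longrightarrow> x K \<noteq> 0 \<Longrightarrow> wt n K > 0"
    and 0: "\<And>K. K \<subseteq> {..<n} \<Longrightarrow> lower n x K = 0" and K: "K \<subseteq> {..<n}"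
  shows "x K = 0"
proof -
  let ?S = "\<Sum>K\<in>Pow {..<n}. gram n K * of_int (wt n K) * (x K)\<^sup>2"
  have "ip n x (lower n (raise n x)) = ip n (raise n x) (raise n x)"
    unfolding ip_lower[symmetric] by (rule ip_commute)
  moreover have "ip n (lower n x) (lower n x) = 0" by (simp add: ip_def 0)
  ultimately have S: "?S \<le> 0" using ip_lower_lower[of n x] ip_nonneg[of n "raise n x"] by linarith
  have nn: "gram n K * of_int (wt n K) * (x K)\<^sup>2 \<ge> 0" if "K \<in> Pow {..<n}" for K
    using x[of K] gram_pos[of K n] that by (cases "x K = 0") auto
  have "?S \<ge> 0" by (rule sum_nonneg) (rule nn)
  with S have "?S = 0" by (rule order_antisym)
  then have "gram n K * of_int (wt n K) * (x K)\<^sup>2 = 0"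
    using nn K by (subst (asm) sum_nonneg_eq_0_iff) auto
  then show ?thesis using x[OF K] gram_pos[OF K] by (cases "x K = 0") auto
qed

text \<open>With \<open>D U x = 0\<close> the identity equates the square norm of \<open>D x\<close>
  with a sum of nonpositive terms, so all of these vanish.\<close>

lemma lower_raise_eq_0D:
  assumes x: "\<And>K. K \<subseteq> {..<n} \<Longrightarrow> x K \<noteq> 0 \<Longrightarrow> wt n K < 0"
    and 0: "\<And>K. K \<subseteq> {..<n} \<Longrightarrow> lower n (raise n x) K = 0" and K: "K \<subseteq> {..<n}"
  shows "x K = 0"
proof -
  let ?S = "\<Sum>K\<in>Pow {..<n}. gram n K * - of_int (wt n K) * (x K)\<^sup>2"
  have "ip n x (lower n (raise n x)) = 0" by (simp add: ip_def 0)
  then have S: "?S \<le> 0" using ip_lower_lower[of n x] ip_nonneg[of n "lower n x"]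
    by (simp add: sum_negf)
  have nn: "gram n K * - of_int (wt n K) * (x K)\<^sup>2 \<ge> 0" if "K \<in> Pow {..<n}" for K
    using x[of K] gram_pos[of K n] that by (cases "x K = 0") (auto simp: mult_nonneg_nonpos mult_nonpos_nonneg)
  have "?S \<ge> 0" by (rule sum_nonneg) (rule nn)
  with S have "?S = 0" by (rule order_antisym)
  then have "gram n K * - of_int (wt n K) * (x K)\<^sup>2 = 0"
    using nn K by (subst (asm) sum_nonneg_eq_0_iff) auto
  then show ?thesis using x[OF K] gram_pos[OF K] by (cases "x K = 0") auto
qed

section \<open>Matrix coefficients of the exterior powers\<close>

text \<open>The coefficient of \<open>e_K\<close> in the product of the vectors
  \<open>S e_j\<close>, \<open>j\<close> running through \<open>js\<close>. A list in place of a set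
  lets inductions split off the first factor.\<close>

definition shift_coeff :: "nat \<Rightarrow> nat list \<Rightarrow> nat set \<Rightarrow> int" where
  "shift_coeff n js = foldr wedge (map (col (jordan_block n 1)) js) ext_one"

lemma shift_coeff_Nil: "shift_coeff n [] K = of_bool (K = {})"
  by (simp add: shift_coeff_def ext_one_def)

text \<open>Over an increasing list all signs of the exterior products are \<open>+1\<close>: the vector
  \<open>e_j + e_(j-1)\<close> is multiplied only with \<open>e_K\<close> such that all elements of \<open>K\<close> are at least \<open>j\<close>.\<close>

lemma shift_coeff_Cons:
  assumes supp: "\<And>K i. shift_coeff n js K \<noteq> 0 \<Longrightarrow> i \<in> K \<Longrightarrow> j \<le> i" and j: "j < n" and K: "finite K"
  shows "shift_coeff n (j # js) K = (if K \<subseteq> {..<n} then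
     of_bool (j \<in> K) * shift_coeff n js (K - {j})
     + of_bool (j > 0 \<and> j - 1 \<in> K) * shift_coeff n js (K - {j - 1}) else 0)"
proof (cases "K \<subseteq> {..<n}")
  case True
  let ?f = "\<lambda>i. (-1) ^ card {k\<in>K. k < i} * (col (jordan_block n 1) j $ i) * shift_coeff n js (K - {i})"
  have col: "col (jordan_block n (1::int)) j $ i = of_bool (i = j) + of_bool (Suc i = j)" if "i \<in> K" for i
    using that True j by (subst index_col) (auto)
  have sgn: "(-1) ^ card {k\<in>K. k < i} * shift_coeff n js (K - {i}) = shift_coeff n js (K - {i})"
    if "i \<le> j" for i
  proof (cases "shift_coeff n js (K - {i}) = 0")
    case False
    have "{k\<in>K. k < i} = {}" using supp[OF False] that by force
    then show ?thesis by (simp only: card.empty) simp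
  qed simp
  have "shift_coeff n (j # js) K = (\<Sum>i\<in>K. ?f i)"
    using True by (simp add: shift_coeff_def wedge_def)
  also have "\<dots> = (\<Sum>i\<in>K. of_bool (i = j) * shift_coeff n js (K - {i})
       + of_bool (Suc i = j) * shift_coeff n js (K - {i}))"
    by (intro sum.cong refl) (use sgn in \<open>auto simp: col algebra_simps\<close>)
  also have "\<dots> = (\<Sum>i\<in>K. if i = j then shift_coeff n js (K - {i}) else 0)
       + (\<Sum>i\<in>K. if Suc i = j then shift_coeff n js (K - {i}) else 0)"
    unfolding sum.distrib by (intro arg_cong2[where f="(+)"] sum.cong) auto
  also have "(\<Sum>i\<in>K. if i = j then shift_coeff n js (K - {i}) else 0) = of_bool (j \<in> K) * shift_coeff n js (K - {j})"
    using K by (auto simp: sum.delta)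
  also have "(\<Sum>i\<in>K. if Suc i = j then shift_coeff n js (K - {i}) else 0)
     = of_bool (j > 0 \<and> j - 1 \<in> K) * shift_coeff n js (K - {j - 1})"
    using K by (cases j) (auto simp: sum.delta)
  finally show ?thesis using True by simp
qed (simp add: shift_coeff_def wedge_def j)

text \<open>Each factor \<open>e_j + e_(j-1)\<close> contributes \<open>j\<close> or
  \<open>j - 1\<close>, so the size is kept and the element sum cannot grow. The last conjunct
  yields, for the tail of an increasing list, the support condition of
  \<open>shift_coeff_Cons\<close>.\<close>

lemma shift_coeff_nonzero:
  assumes "sorted_wrt (<) js" "set js \<subseteq> {..<n}" "shift_coeff n js K \<noteq> 0" 
  shows "K \<subseteq> {..<n} \<and> card K = length js \<and> \<Sum>K \<le> sum_list js \<and> (\<forall>i\<in>K. \<exists>j\<in>set js. j \<le> Suc i)"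
  using assms
proof (induction js arbitrary: K)
  case Nil
  then show ?case by (auto simp: shift_coeff_Nil split: if_splits)
next
  case (Cons j js)
  have K: "K \<subseteq> {..<n}"
    using Cons.prems(2,3) by (simp add: shift_coeff_def wedge_def split: if_splits)
  then have fin: "finite K" using finite_subset by auto
  have supp: "j \<le> i" if "shift_coeff n js K' \<noteq> 0" "i \<in> K'" for K' i
    using Cons.IH[OF _ _ that(1)] Cons.prems(1,2) that(2) by fastforce
  have eq: "shift_coeff n (j # js) K = of_bool (j \<in> K) * shift_coeff n js (K - {j})
     + of_bool (j > 0 \<and> j - 1 \<in> K) * shift_coeff n js (K - {j - 1})"
    using shift_coeff_Cons[of n js j K] supp Cons.prems(2) fin K by auto
  \<comment> \<open>\<open>i\<close> is the position contributed by the head factor, either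
    \<open>j\<close> or \<open>j - 1\<close>.\<close>
  obtain i where i: "i \<in> K" "i \<le> j" "j \<le> Suc i" "shift_coeff n js (K - {i}) \<noteq> 0"
  proof (cases "j \<in> K \<and> shift_coeff n js (K - {j}) \<noteq> 0")
    case True
    then show ?thesis using that[of j] by simp
  next
    case False
    then have "of_bool (j \<in> K) * shift_coeff n js (K - {j}) = 0" by auto
    then have "j > 0 \<and> j - 1 \<in> K" "shift_coeff n js (K - {j - 1}) \<noteq> 0"
      using eq Cons.prems(3) by auto
    then show ?thesis using that[of "j - 1"] by simp
  qed
  have IH: "card (K - {i}) = length js" "\<Sum>(K - {i}) \<le> sum_list js"
     "\<forall>i\<in>K - {i}. \<exists>j\<in>set js. j \<le> Suc i"
    using Cons.IH[OF _ _ i(4)] Cons.prems(1,2) by simp_all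
  have "card K = Suc (card (K - {i}))" using fin i(1) by (rule card.remove)
  moreover have "\<Sum>K = i + \<Sum>(K - {i})" using fin i(1) by (simp add: sum.remove)
  moreover have "\<forall>i\<in>K. \<exists>j\<in>set (j # js). j \<le> Suc i"
  proof
    fix k assume "k \<in> K"
    then show "\<exists>j\<in>set (j # js). j \<le> Suc k"
      using IH(3) i(3) by (cases "k = i") auto
  qed
  ultimately show ?case using IH(1,2) K i(2) by simp
qed

lemma shift_coeff_Cons':
  assumes "sorted_wrt (<) (j # js)" "set (j # js) \<subseteq> {..<n}" "K \<subseteq> {..<n}"
  shows "shift_coeff n (j # js) K = of_bool (j \<in> K) * shift_coeff n js (K - {j})
     + of_bool (j > 0 \<and> j - 1 \<in> K) * shift_coeff n js (K - {j - 1})"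
proof -
  have supp: "j \<le> i" if "shift_coeff n js K' \<noteq> 0" "i \<in> K'" for K' i
    using shift_coeff_nonzero[OF _ _ that(1)] assms(1,2) that(2) by fastforce
  show ?thesis
    by (subst shift_coeff_Cons) (use assms finite_subset[OF assms(3)] supp in auto)
qed

text \<open>Any factor contributing \<open>j - 1\<close> strictly lowers the sum, so here every
  factor must contribute its own \<open>j\<close>: the matrix is unitriangular with respect to the
  element sum.\<close>

lemma shift_coeff_top:
  assumes "sorted_wrt (<) js" "set js \<subseteq> {..<n}" "K \<subseteq> {..<n}" "sum_list js \<le> \<Sum>K"
  shows "shift_coeff n js K = of_bool (K = set js)"
  using assms
proof (induction js arbitrary: K)
  case Nil
  then show ?case by (simp add: shift_coeff_Nil)
next
  case (Cons j js)
  have fin: "finite K" using Cons.prems(3) finite_subset by auto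
  have nin: "j \<notin> set js" using Cons.prems(1) by auto
  have sumK: "\<Sum>K = i + \<Sum>(K - {i})" if "i \<in> K" for i
    using fin that by (simp add: sum.remove)
  have 1: "shift_coeff n js (K - {j}) = of_bool (K - {j} = set js)" if "j \<in> K"
  proof (rule Cons.IH)
    show "sum_list js \<le> \<Sum>(K - {j})" using Cons.prems(4) sumK[OF that] by simp
  qed (use Cons.prems(1-3) in auto)
  have 2: "shift_coeff n js (K - {j - 1}) = 0" if "j > 0" "j - 1 \<in> K"
  proof (rule ccontr)
    assume "shift_coeff n js (K - {j - 1}) \<noteq> 0"
    then have "\<Sum>(K - {j - 1}) \<le> sum_list js" 
      using shift_coeff_nonzero[of js n "K - {j - 1}"] Cons.prems(1,2) by simp
    then show False using Cons.prems(4) sumK[OF that(2)] that(1) by simp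
  qed
  have "shift_coeff n (j # js) K = of_bool (j \<in> K \<and> K - {j} = set js)"
    using 1 2 unfolding shift_coeff_Cons'[OF Cons.prems(1-3)] by (cases "j \<in> K") auto
  also have "(j \<in> K \<and> K - {j} = set js) \<longleftrightarrow> K = set (j # js)" using nin by auto
  finally show ?case .
qed

text \<open>A drop of one means that exactly one factor contributes \<open>j - 1\<close>. This is
  the matrix entry of the derivation \<open>D\<close>. Either the head stays and the tail drops by
  one, or the head moves and \<open>shift_coeff_top\<close> fixes the tail.\<close>

lemma shift_coeff_next:
  assumes "sorted_wrt (<) js" "set js \<subseteq> {..<n}" "K \<subseteq> {..<n}" "sum_list js = Suc (\<Sum>K)"
  shows "shift_coeff n js K = of_bool (\<exists>a. a \<in> K \<and> Suc a \<notin> K \<and> set js = flip a K)"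
  using assms
proof (induction js arbitrary: K)
  case Nil
  then show ?case by simp
next
  case (Cons j js)
  have fin: "finite K" using Cons.prems(3) finite_subset by auto
  have gt: "\<forall>i\<in>set js. j < i" using Cons.prems(1) by auto
  have sumK: "\<Sum>K = i + \<Sum>(K - {i})" if "i \<in> K" for i
    using fin that by (simp add: sum.remove)
  have 1: "shift_coeff n js (K - {j}) = of_bool (\<exists>a. a \<in> K - {j} \<and> Suc a \<notin> K - {j} \<and> set js = flip a (K - {j}))" if "j \<in> K"
  proof (rule Cons.IH)
    show "sum_list js = Suc (\<Sum>(K - {j}))" using Cons.prems(4) sumK[OF that] by simp
  qed (use Cons.prems(1-3) in auto)
  have 2: "shift_coeff n js (K - {j - 1}) = of_bool (K - {j - 1} = set js)" if "j > 0" "j - 1 \<in> K"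
  proof (rule shift_coeff_top)
    show "sum_list js \<le> \<Sum>(K - {j - 1})" using Cons.prems(4) sumK[OF that(2)] that(1) by simp
  qed (use Cons.prems(1-3) in auto)
  show ?case 
  proof (cases "j \<in> K")
    case True
    have "(\<exists>a. a \<in> K - {j} \<and> Suc a \<notin> K - {j} \<and> set js = flip a (K - {j})) \<longleftrightarrow>
        (\<exists>a. a \<in> K \<and> Suc a \<notin> K \<and> set (j # js) = flip a K)" (is "(\<exists>a. ?P a) \<longleftrightarrow> (\<exists>a. ?Q a)")
    proof (intro iff_exI iffI)
      fix a assume P: "?P a"
      have "Suc a \<noteq> j"
      proof
        assume "Suc a = j"
        then have "j \<in> flip a (K - {j})" by simp
        with P have "j \<in> set js" by (simp only:)
        then show False using gt by blast
      qed
      then have "set js = flip a K - {j}" "j \<in> flip a K"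
        using P True flip_remove[of j a K] by (simp_all del: mem_flip add: mem_flip[of j])
      then have "set (j # js) = flip a K" by (simp add: insert_absorb)
      then show "?Q a" using P \<open>Suc a \<noteq> j\<close> by simp
    next
      fix a assume Q: "?Q a"
      then have set: "flip a K = insert j (set js)" by simp
      then have "j \<in> flip a K" by simp
      then have ja: "j \<noteq> a" "j \<noteq> Suc a" using Q True by auto
      moreover have "set js = flip a K - {j}" unfolding set using gt by blast
      ultimately show "?P a" using Q flip_remove[OF ja] by simp
    qed
    \<comment> \<open>If the head contributed \<open>j - 1\<close>, the tail would have to produce
      \<open>j\<close> unmoved, but all its indices exceed \<open>j\<close>.\<close>
    moreover have "of_bool (j > 0 \<and> j - 1 \<in> K) * shift_coeff n js (K - {j - 1}) = 0"
    proof (cases "j > 0 \<and> j - 1 \<in> K")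
      case less: True
      then have "j \<in> K - {j - 1}" using True by auto
      then have "K - {j - 1} \<noteq> set js" using gt by blast
      then show ?thesis using 2 less by simp
    qed simp
    ultimately show ?thesis
      unfolding shift_coeff_Cons'[OF Cons.prems(1-3)] 1[OF True] using True by simp
  next
    case False
    \<comment> \<open>Since \<open>j\<close> is missing from \<open>K\<close>, the head is the
      factor that moves, and \<open>a = j - 1\<close>.\<close>
    have "(j > 0 \<and> j - 1 \<in> K \<and> K - {j - 1} = set js) \<longleftrightarrow>
        (\<exists>a. a \<in> K \<and> Suc a \<notin> K \<and> set (j # js) = flip a K)" (is "?P \<longleftrightarrow> ?Q")
    proof
      assume ?P
      then have "flip (j - 1) K = insert j (K - {j - 1})" using False by (subst flip_down) auto
      moreover have "Suc (j - 1) = j" using \<open>?P\<close> by simp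
      ultimately show ?Q using \<open>?P\<close> False by (intro exI[of _ "j - 1"]) (simp only: list.set simp_thms)
    next
      assume ?Q
      then obtain a where a: "a \<in> K" "Suc a \<notin> K" "set (j # js) = flip a K" by auto
      have "j \<in> flip a K" using a(3)[symmetric] by simp
      with False have "j = Suc a" using a(1) by auto
      moreover have "set js = flip a K - {j}"
        unfolding a(3)[symmetric] using gt by auto
      moreover have "flip a K - {Suc a} = K - {a}"
        unfolding flip_down[OF a(1,2)] using a(2) by blast
      ultimately show ?P using a(1) by simp
    qed
    moreover have "shift_coeff n (j # js) K = of_bool (j > 0 \<and> j - 1 \<in> K \<and> K - {j - 1} = set js)"
      unfolding shift_coeff_Cons'[OF Cons.prems(1-3)] using 2 False
      by (cases "j > 0 \<and> j - 1 \<in> K") (simp, auto)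
    ultimately show ?thesis by (simp only:)
  qed
qed

section \<open>Dimensions of kernels\<close>

context vector_space begin

text \<open>A basis of the kernel and the image under \<open>u\<close> of a basis of \<open>W\<close> make up a basis of \<open>V\<close>.\<close>

lemma dim_kernel_add:
  assumes f: "Vector_Spaces.linear scale scale f" and u: "Vector_Spaces.linear scale scale u"
    and V: "subspace V" and T: "finite T" "V \<subseteq> span T" and W: "subspace W"
    and fV: "f ` V \<subseteq> W" and uW: "u ` W \<subseteq> V" and inj: "\<And>w. w \<in> W \<Longrightarrow> f (u w) = 0 \<Longrightarrow> w = 0"
  shows "dim {v \<in> V. f v = 0} + dim W = dim V"
proof -
  interpret f: Vector_Spaces.linear scale scale f by (rule f)
  interpret u: Vector_Spaces.linear scale scale u by (rule u)
  interpret fu: Vector_Spaces.linear scale scale "f \<circ> u" by (rule Vector_Spaces.linear_compose[OF u f])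
  let ?K = "{v \<in> V. f v = 0}"
  have K: "subspace ?K" using subspace_inter[OF V f.subspace_kernel] by (simp add: Int_def)
  obtain B where B: "B \<subseteq> ?K" "independent B" "?K \<subseteq> span B" "card B = dim ?K"
    by (rule basis_exists)
  obtain C where C: "C \<subseteq> W" "independent C" "W \<subseteq> span C" "card C = dim W"
    by (rule basis_exists)
  have spanC: "span C = W" using C W by (intro span_subspace)
  have inj_fu: "inj_on (f \<circ> u) (span C)"
    unfolding spanC fu.inj_on_iff_eq_0[OF W] using inj by auto
  have inj_u: "inj_on u C" 
    using inj_on_imageI2[OF inj_on_subset[OF inj_fu span_superset]] .
  have ind_fu: "independent ((f \<circ> u) ` C)"
    by (rule fu.independent_injective_image[OF C(2) inj_fu])
  have ind_u: "independent (u ` C)"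
    using u.independent_injective_image[OF C(2)] inj_on_imageI2[OF inj_fu] by blast
  have "finite (u ` C)"
    using independent_span_bound[OF T(1) ind_u] C(1) uW T(2) by blast
  then have finC: "finite C" using inj_u finite_imageD by blast
  have finB: "finite B"
    using independent_span_bound[OF T(1) B(2)] B(1) T(2) by blast
  have card_fu: "card ((f \<circ> u) ` C) = card C"
    using inj_on_subset[OF inj_fu span_superset] by (rule card_image)
  \<comment> \<open>\<open>f \<circ> u\<close> maps \<open>W\<close> injectively into itself, hence
    onto by dimension: a vector outside the span of the image of \<open>C\<close> would give
    \<open>card C + 1\<close> independent vectors in \<open>span C\<close>.\<close>
  have W_fu: "W \<subseteq> span ((f \<circ> u) ` C)"
  proof
    fix w assume w: "w \<in> W"
    show "w \<in> span ((f \<circ> u) ` C)"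
    proof (rule ccontr)
      assume nin: "w \<notin> span ((f \<circ> u) ` C)"
      then have "independent (insert w ((f \<circ> u) ` C))" by (rule independent_insertI[OF _ ind_fu])
      moreover have "insert w ((f \<circ> u) ` C) \<subseteq> span C" using w C(1) uW fV spanC by auto
      ultimately have "card (insert w ((f \<circ> u) ` C)) \<le> card C"
        using independent_span_bound[OF finC] by blast
      moreover have "w \<notin> (f \<circ> u) ` C" using nin span_base by blast
      ultimately show False using card_fu finC by simp
    qed
  qed
  \<comment> \<open>The images \<open>u c\<close> are added to \<open>B\<close> one at a time. A
    linear relation for a new \<open>u c\<close> is refuted by applying \<open>f\<close>, which
    kills \<open>B\<close> and is injective after \<open>u\<close>.\<close>
  have ind: "independent (B \<union> u ` C') \<and> card (B \<union> u ` C') = card B + card C'" if "C' \<subseteq> C" for C'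
    using finite_subset[OF that finC] that
  proof (induction C' rule: finite_induct)
    case empty
    then show ?case using B(2) by simp
  next
    case (insert c C')
    have fuc: "f (u c) \<notin> span ((f \<circ> u) ` C')"
    proof
      assume "f (u c) \<in> span ((f \<circ> u) ` C')"
      then have "f (u c) \<in> (f \<circ> u) ` span C'" unfolding fu.span_image .
      then obtain d where d: "d \<in> span C'" "(f \<circ> u) c = (f \<circ> u) d" by auto
      have "span C' \<subseteq> span C" using insert.prems by (intro span_mono) auto
      with d(1) have "d \<in> span C" by blast
      moreover have "c \<in> span C" using insert.prems by (intro span_base) auto
      ultimately have "c = d" by (intro inj_onD[OF inj_fu d(2)])
      moreover have "span C' \<subseteq> span (C - {c})" using insert.hyps(2) insert.prems by (intro span_mono) auto
      ultimately have "c \<in> span (C - {c})" using d(1) by blast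
      then show False using C(2) insert.prems unfolding dependent_def by blast
    qed
    have nin: "u c \<notin> span (B \<union> u ` C')"
    proof
      assume "u c \<in> span (B \<union> u ` C')"
      then have "f (u c) \<in> span (f ` (B \<union> u ` C'))" unfolding f.span_image by simp
      moreover have "f ` (B \<union> u ` C') \<subseteq> insert 0 ((f \<circ> u) ` C')" using B(1) by auto
      then have "span (f ` (B \<union> u ` C')) \<subseteq> span (insert 0 ((f \<circ> u) ` C'))"
        by (rule span_mono)
      ultimately show False using fuc unfolding span_insert_0 by blast
    qed
    have nin': "u c \<notin> B \<union> u ` C'" by (rule contra_subsetD[OF span_superset nin])
    have IH: "independent (B \<union> u ` C')" "card (B \<union> u ` C') = card B + card C'"
      using insert.IH insert.prems by auto
    have eq: "B \<union> u ` insert c C' = insert (u c) (B \<union> u ` C')" by simp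
    show ?case
      unfolding eq
    proof (rule conjI)
      show "independent (insert (u c) (B \<union> u ` C'))"
        by (rule independent_insertI[OF nin IH(1)])
      show "card (insert (u c) (B \<union> u ` C')) = card B + card (insert c C')"
        using insert.hyps finB nin' IH(2) by (subst card_insert_disjoint) simp_all
    qed
  qed
  \<comment> \<open>Choose \<open>w\<close> with \<open>f (u w) = f v\<close>; then
    \<open>v - u w\<close> lies in the kernel, which \<open>B\<close> spans.\<close>
  have "V \<subseteq> span (B \<union> u ` C)"
  proof
    fix v assume v: "v \<in> V"
    then have "f v \<in> (f \<circ> u) ` span C" using W_fu fV unfolding fu.span_image by auto
    then obtain w where w: "w \<in> span C" "f v = f (u w)" by auto
    have "u w \<in> V" using w(1) uW spanC by blast
    then have "v - u w \<in> V" by (rule subspace_diff[OF V v])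
    then have "v - u w \<in> ?K" using w(2) by (simp add: f.diff)
    then have "v - u w \<in> span (B \<union> u ` C)" using B(3) span_mono[of B "B \<union> u ` C"] by blast
    moreover have "u w \<in> span (B \<union> u ` C)"
      using w(1) u.span_image[of C] span_mono[of "u ` C" "B \<union> u ` C"] by blast
    ultimately show "v \<in> span (B \<union> u ` C)" using span_add[of "v - u w" _ "u w"] by (simp only: diff_add_cancel)
  qed
  moreover have "B \<union> u ` C \<subseteq> V" using B(1) C(1) uW by auto
  ultimately have "dim V = card (B \<union> u ` C)"
    using ind[OF subset_refl] basis_card_eq_dim[of "B \<union> u ` C" V] by simp
  then show ?thesis using ind[OF subset_refl] B(4) C(4) by simp
qed

end

section \<open>Coordinate subspaces of rational function spaces\<close>

global_interpretation fun_space: vector_space "\<lambda>(c::rat) (x::'a \<Rightarrow> rat) i. c * x i"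
  by unfold_locales (auto simp: fun_eq_iff algebra_simps)

definition supp_space :: "'a set \<Rightarrow> ('a \<Rightarrow> rat) set" where
  "supp_space X = {x. \<forall>i. i \<notin> X \<longrightarrow> x i = 0}"

definition unit_fun :: "'a \<Rightarrow> 'a \<Rightarrow> rat" where
  "unit_fun i j = of_bool (i = j)"

lemma sum_fun_apply: "(\<Sum>a\<in>A. f a) i = (\<Sum>a\<in>A. f a i)"
  by (induction A rule: infinite_finite_induct) auto

lemma subspace_supp_space: "fun_space.subspace (supp_space X)"
  by (auto simp: fun_space.subspace_def supp_space_def)

lemma unit_fun_expansion:
  assumes "finite X" "x \<in> supp_space X"
  shows "x = (\<Sum>i\<in>X. (\<lambda>j. x i * unit_fun i j))"
  using assms
  by (auto simp: fun_eq_iff sum_fun_apply unit_fun_def supp_space_def of_bool_def if_distrib cong: if_cong)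

lemma supp_space_subset_span:
  assumes "finite X"
  shows "supp_space X \<subseteq> fun_space.span (unit_fun ` X)"
proof
  fix x :: "'a \<Rightarrow> rat" assume "x \<in> supp_space X"
  then have "x = (\<Sum>i\<in>X. (\<lambda>j. x i * unit_fun i j))" by (rule unit_fun_expansion[OF assms])
  also have "\<dots> \<in> fun_space.span (unit_fun ` X)"
    by (intro fun_space.span_sum fun_space.span_scale fun_space.span_base imageI)
  finally show "x \<in> fun_space.span (unit_fun ` X)" .
qed

lemma inj_unit_fun: "inj unit_fun"
proof (rule injI)
  fix i j :: 'a assume "unit_fun i = unit_fun j"
  then have "unit_fun i j = unit_fun j j" by simp
  then show "i = j" by (simp add: unit_fun_def split: if_splits)
qed

lemma dim_supp_space:
  assumes "finite X"
  shows "fun_space.dim (supp_space X) = card X"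
proof (rule fun_space.dim_unique)
  show "card (unit_fun ` X) = card X"
    using inj_unit_fun by (intro card_image) (auto intro: inj_on_subset)
  show "fun_space.independent (unit_fun ` X)"
    unfolding fun_space.dependent_finite[OF finite_imageI[OF assms]]
  proof clarify
    fix u i assume 0: "(\<Sum>v\<in>unit_fun ` X. (\<lambda>j. u v * v j)) = 0" and i: "i \<in> X" "u (unit_fun i) \<noteq> 0"
    have "0 = (\<Sum>v\<in>unit_fun ` X. (\<lambda>j. u v * v j)) i" unfolding 0 by simp
    also have "\<dots> = (\<Sum>k\<in>X. u (unit_fun k) * unit_fun k i)"
      unfolding sum_fun_apply using inj_unit_fun by (subst sum.reindex) (auto intro: inj_on_subset)
    also have "\<dots> = u (unit_fun i)"
      using i assms by (simp add: unit_fun_def of_bool_def if_distrib cong: if_cong)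
    finally show False using i by simp
  qed
qed (use supp_space_subset_span[OF assms] in \<open>auto simp: supp_space_def unit_fun_def\<close>)

section \<open>The exterior power of the Jordan block minus the identity, over the rationals\<close>

definition ext_sets :: "nat \<Rightarrow> nat \<Rightarrow> nat set set" where
  "ext_sets r n = {I. I \<subseteq> {..<n} \<and> card I = r}"

definition ext_diff :: "nat \<Rightarrow> nat \<Rightarrow> (nat set \<Rightarrow> rat) \<Rightarrow> nat set \<Rightarrow> rat" where
  "ext_diff r n x K =
     (\<Sum>J\<in>ext_sets r n. x J * of_int (shift_coeff n (sorted_list_of_set J) K)) - x K"

lemma finite_ext_sets [simp]: "finite (ext_sets r n)"
  unfolding ext_sets_def by (rule finite_subset[of _ "Pow {..<n}"]) auto

lemma finite_mem_ext_sets: "I \<in> ext_sets r n \<Longrightarrow> finite I"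
  by (auto simp: ext_sets_def intro: finite_subset)

lemma sum_list_sorted_list_of_set: "finite J \<Longrightarrow> sum_list (sorted_list_of_set J) = \<Sum>(J :: nat set)"
  using sum_list_distinct_conv_sum_set[of "sorted_list_of_set J" "\<lambda>x. x"] by simp

text \<open>For fixed \<open>r\<close>, all weights have the same parity, and raising the element
  sum by one raises the weight by two. Comparisons of weights thus become comparisons of element
  sums.\<close>

lemma wt_ext_sets: "I \<in> ext_sets r n \<Longrightarrow> wt n I = 2 * int (\<Sum>I) + int r - int r * int n"
  by (simp add: wt_def ext_sets_def sum.distrib sum_subtractf sum_distrib_left[symmetric] of_nat_sum)

lemma finite_flip: "finite K \<Longrightarrow> finite (flip a K)"
  by (rule finite_subset[of _ "insert a (insert (Suc a) K)"]) (auto simp: flip_def)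

lemma sum_flip:
  assumes "finite K" "a \<in> K" "Suc a \<notin> K"
  shows "\<Sum>(flip a K) = Suc (\<Sum>K)"
  using assms sum.remove[of K a "\<lambda>x. x"] unfolding flip_down[OF assms(2,3)] by simp

lemma card_flip:
  assumes "finite K" "a \<in> K" "Suc a \<notin> K"
  shows "card (flip a K) = card K"
  using assms card.remove[of K a] unfolding flip_down[OF assms(2,3)] by simp

lemma sum_flip_up:
  assumes "finite K" "a \<notin> K" "Suc a \<in> K"
  shows "\<Sum>K = Suc (\<Sum>(flip a K))"
  using assms sum_flip[of "flip a K" a] finite_flip[of K a] by simp

lemma flip_mem_ext_sets:
  assumes "K \<in> ext_sets r n" "a \<notin> K" "Suc a \<in> K"
  shows "flip a K \<in> ext_sets r n"
proof -
  have "finite (flip a K)" by (rule finite_flip[OF finite_mem_ext_sets[OF assms(1)]])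
  then have "card K = card (flip a K)" using card_flip[of "flip a K" a] assms(2,3) by simp
  then show ?thesis using assms by (auto simp: ext_sets_def flip_up)
qed

text \<open>Unitriangularity in terms of sets. Outside \<open>ext_sets r n\<close> both sides
  vanish, so this case can share the formula.\<close>

lemma shift_coeff_sorted_list_of_set:
  assumes J: "J \<in> ext_sets r n" and K: "K \<notin> ext_sets r n \<or> \<Sum>J \<le> \<Sum>K"
  shows "shift_coeff n (sorted_list_of_set J) K = of_bool (J = K)"
proof (cases "K \<in> ext_sets r n")
  case True
  have "finite J" by (rule finite_mem_ext_sets[OF J])
  then have "shift_coeff n (sorted_list_of_set J) K = of_bool (K = set (sorted_list_of_set J))"
    using J K True by (intro shift_coeff_top) (auto simp: ext_sets_def sum_list_sorted_list_of_set)
  then show ?thesis using \<open>finite J\<close> by auto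
next
  case False
  have "finite J" by (rule finite_mem_ext_sets[OF J])
  have "shift_coeff n (sorted_list_of_set J) K = 0"
  proof (rule ccontr)
    assume "shift_coeff n (sorted_list_of_set J) K \<noteq> 0"
    then have "K \<subseteq> {..<n} \<and> card K = length (sorted_list_of_set J)"
      using shift_coeff_nonzero[of "sorted_list_of_set J" n K] J \<open>finite J\<close> by (auto simp: ext_sets_def)
    then show False using False J by (simp add: ext_sets_def)
  qed
  then show ?thesis using False J by auto
qed

text \<open>With the identity moved inside the sum, every term with
  \<open>\<Sum>J \<le> \<Sum>K\<close> vanishes individually.\<close>

lemma ext_diff_altdef:
  assumes "x \<in> supp_space (ext_sets r n)"
  shows "ext_diff r n x K =
    (\<Sum>J\<in>ext_sets r n. x J * (of_int (shift_coeff n (sorted_list_of_set J) K) - of_bool (J = K)))"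
proof -
  have "x K = (\<Sum>J\<in>ext_sets r n. x J * of_bool (J = K))"
    using assms by (auto simp: supp_space_def of_bool_def if_distrib cong: if_cong)
  then show ?thesis unfolding ext_diff_def right_diff_distrib sum_subtractf by (simp only:)
qed

text \<open>The leading component is \<open>D\<close>: at \<open>K\<close> only those
  \<open>J\<close> contribute whose sum exceeds that of \<open>K\<close> by exactly one, and their
  coefficients are given by \<open>shift_coeff_next\<close>.\<close>

lemma ext_diff_eq_lower:
  assumes x: "x \<in> supp_space (ext_sets r n)" and K: "K \<in> ext_sets r n"
    and le: "\<And>J. x J \<noteq> 0 \<Longrightarrow> \<Sum>J \<le> Suc (\<Sum>K)"
  shows "ext_diff r n x K = lower n x K"
proof -
  let ?A = "{a. a < n - 1 \<and> a \<in> K \<and> Suc a \<notin> K}"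
  have K': "finite K" "K \<subseteq> {..<n}" using finite_mem_ext_sets[OF K] K by (simp_all add: ext_sets_def)
  have "x J * (of_int (shift_coeff n (sorted_list_of_set J) K) - of_bool (J = K))
      = (if J \<in> (\<lambda>a. flip a K) ` ?A then x J else 0)" if J: "J \<in> ext_sets r n" for J
  proof (cases "x J = 0")
    case False
    have fin: "finite J" by (rule finite_mem_ext_sets[OF J])
    consider "\<Sum>J \<le> \<Sum>K" | "\<Sum>J = Suc (\<Sum>K)" using le[OF False] by linarith
    then show ?thesis
    proof cases
      case 1
      then have "J \<notin> (\<lambda>a. flip a K) ` ?A" using sum_flip[OF K'(1)] by auto
      then show ?thesis using shift_coeff_sorted_list_of_set[OF J] 1 by simp
    next
      case 2
      then have "J \<noteq> K" by auto
      have "shift_coeff n (sorted_list_of_set J) K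
          = of_bool (\<exists>a. a \<in> K \<and> Suc a \<notin> K \<and> set (sorted_list_of_set J) = flip a K)"
        using J K' 2 fin by (intro shift_coeff_next) (auto simp: ext_sets_def sum_list_sorted_list_of_set)
      also have "(\<exists>a. a \<in> K \<and> Suc a \<notin> K \<and> set (sorted_list_of_set J) = flip a K) \<longleftrightarrow> J \<in> (\<lambda>a. flip a K) ` ?A"
      proof
        assume "\<exists>a. a \<in> K \<and> Suc a \<notin> K \<and> set (sorted_list_of_set J) = flip a K"
        then obtain a where a: "a \<in> K" "Suc a \<notin> K" "J = flip a K" using fin by auto
        then have "Suc a \<in> J" by simp
        then have "Suc a < n" using J by (auto simp: ext_sets_def)
        then show "J \<in> (\<lambda>a. flip a K) ` ?A" using a by auto
      qed (use fin in auto)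
      finally show ?thesis using \<open>J \<noteq> K\<close> by simp
    qed
  qed simp
  then have "ext_diff r n x K = (\<Sum>J\<in>ext_sets r n. if J \<in> (\<lambda>a. flip a K) ` ?A then x J else 0)"
    unfolding ext_diff_altdef[OF x] by (intro sum.cong refl)
  also have "\<dots> = (\<Sum>J\<in>ext_sets r n \<inter> (\<lambda>a. flip a K) ` ?A. x J)"
    by (rule sum.inter_restrict[symmetric]) simp
  also have "\<dots> = (\<Sum>J\<in>(\<lambda>a. flip a K) ` ?A. x J)"
    using x by (intro sum.mono_neutral_left) (auto simp: supp_space_def)
  also have "\<dots> = (\<Sum>a\<in>?A. x (flip a K))"
  proof (rule sum.reindex_cong[OF _ refl refl])
    show "inj_on (\<lambda>a. flip a K) ?A"
    proof (rule inj_onI, clarify)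
      fix a b assume "flip a K = flip b K" "a \<in> K" "Suc a \<notin> K" "b \<in> K" "Suc b \<notin> K"
      then have "(a \<in> flip b K) = (a \<in> flip a K)" "(b \<in> flip a K) = (b \<in> flip b K)" by simp_all
      with \<open>a \<in> K\<close> \<open>b \<in> K\<close> \<open>Suc a \<notin> K\<close> \<open>Suc b \<notin> K\<close> show "a = b" by (auto split: if_splits)
    qed
  qed
  also have "\<dots> = lower n x K"
    unfolding lower_def by (subst sum.inter_filter[symmetric]) (auto intro!: sum.cong)
  finally show ?thesis .
qed

section \<open>Components of highest weight\<close>

lemma supp_space_Max_sum:
  assumes x: "x \<in> supp_space (ext_sets r n)" and J: "x J \<noteq> 0"
  obtains I where "x I \<noteq> 0" "I \<in> ext_sets r n" "\<And>L. x L \<noteq> 0 \<Longrightarrow> \<Sum>L \<le> \<Sum>I"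
proof -
  have fin: "finite {I. x I \<noteq> 0}"
    using x by (intro finite_subset[OF _ finite_ext_sets[of r n]]) (auto simp: supp_space_def)
  let ?M = "Max (sum (\<lambda>i. i) ` {I. x I \<noteq> 0})"
  have "?M \<in> sum (\<lambda>i. i) ` {I. x I \<noteq> 0}" using fin J by (intro Max_in) auto
  then obtain I where I: "x I \<noteq> 0" "?M = \<Sum>I" by auto
  moreover have "\<Sum>L \<le> \<Sum>I" if "x L \<noteq> 0" for L
    unfolding I(2)[symmetric] using fin that by (intro Max_ge) auto
  moreover have "I \<in> ext_sets r n" using I(1) x by (auto simp: supp_space_def)
  ultimately show ?thesis using that by blast
qed

text \<open>\<open>D\<close> lowers the element sum by exactly one, so it commutes with taking
  homogeneous components up to this shift.\<close>

lemma lower_graded: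
  assumes "finite K"
  shows "lower n (\<lambda>J. if \<Sum>J = k then x J else 0) K = (if Suc (\<Sum>K) = k then lower n x K else 0)"
  unfolding lower_def using sum_flip[OF assms] by (auto intro!: sum.cong sum.neutral)

lemma raise_graded:
  assumes "finite K"
  shows "raise n (\<lambda>J. if \<Sum>J = k then x J else 0) K = (if \<Sum>K = Suc k then raise n x K else 0)"
  unfolding raise_def using sum_flip_up[OF assms] by (auto intro!: sum.cong sum.neutral)

lemma lower_mem_supp_space:
  assumes "x \<in> supp_space (ext_sets r n)"
  shows "lower n x \<in> supp_space (ext_sets r n)"
proof -
  have "lower n x K = 0" if "K \<notin> ext_sets r n" for K
  proof -
    have "x (flip a K) = 0" if a: "a \<in> K" "Suc a \<notin> K" for a
    proof (rule ccontr)
      assume "x (flip a K) \<noteq> 0"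
      then have "flip a K \<in> ext_sets r n" using assms by (auto simp: supp_space_def)
      then have "flip a (flip a K) \<in> ext_sets r n" by (rule flip_mem_ext_sets) (use a in simp_all)
      then show False using \<open>K \<notin> ext_sets r n\<close> by simp
    qed
    then show ?thesis unfolding lower_def by (intro sum.neutral) auto
  qed
  then show ?thesis by (simp add: supp_space_def)
qed

lemma raise_nonzeroE:
  assumes "raise n x K \<noteq> 0"
  obtains a where "a \<notin> K" "Suc a \<in> K" "x (flip a K) \<noteq> 0"
proof -
  have "\<exists>a. a \<notin> K \<and> Suc a \<in> K \<and> x (flip a K) \<noteq> 0"
  proof (rule ccontr)
    assume "\<not> ?thesis"
    then have "raise n x K = 0" unfolding raise_def by (intro sum.neutral) auto
    then show False using assms by simp
  qed
  then show ?thesis using that by blast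
qed

lemma raise_mem_supp_space:
  assumes "x \<in> supp_space (ext_sets r n)"
  shows "raise n x \<in> supp_space (ext_sets r n)"
proof -
  have "raise n x K = 0" if "K \<notin> ext_sets r n" for K
  proof -
    have "x (flip a K) = 0" if a: "a < n - 1" "a \<notin> K" "Suc a \<in> K" for a
    proof (rule ccontr)
      assume "x (flip a K) \<noteq> 0"
      then have *: "flip a K \<in> ext_sets r n" using assms by (auto simp: supp_space_def)
      then have "finite (flip a K)" by (rule finite_mem_ext_sets)
      then have "card K = card (flip a K)" using card_flip[of "flip a K" a] a by simp
      moreover have "K \<subseteq> {..<n}" using flip_subset[of "flip a K" n a] a * by (simp add: ext_sets_def)
      ultimately show False using * \<open>K \<notin> ext_sets r n\<close> by (simp add: ext_sets_def)
    qed
    then show ?thesis unfolding raise_def by (intro sum.neutral) auto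
  qed
  then show ?thesis by (simp add: supp_space_def)
qed

text \<open>If some weight is positive, the component of highest weight is a nonzero vector of
  positive weight killed by \<open>D\<close>, contradicting \<open>lower_eq_0D\<close>.\<close>

lemma ext_diff_eq_0D:
  assumes x: "x \<in> supp_space (ext_sets r n)" and 0: "ext_diff r n x = 0" and J: "x J \<noteq> 0"
  shows "wt n J \<le> 0"
proof (rule ccontr)
  assume wtJ: "\<not> wt n J \<le> 0"
  obtain I where I: "x I \<noteq> 0" "I \<in> ext_sets r n" "\<And>L. x L \<noteq> 0 \<Longrightarrow> \<Sum>L \<le> \<Sum>I"
    using supp_space_Max_sum[OF x J] by blast
  define y where "y = (\<lambda>J. if \<Sum>J = \<Sum>I then x J else 0)"
  have supp: "L \<in> ext_sets r n" if "x L \<noteq> 0" for L using x that by (auto simp: supp_space_def)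
  have "y I = 0"
  proof (rule lower_eq_0D[of n])
    fix K assume K: "K \<subseteq> {..<n}" "y K \<noteq> 0"
    then have "x K \<noteq> 0" "\<Sum>K = \<Sum>I" by (auto simp: y_def split: if_splits)
    then show "wt n K > 0"
      using wtJ I(3)[OF J] supp[OF J] supp[of K] by (simp add: wt_ext_sets del: of_nat_sum)
  next
    fix K assume K: "K \<subseteq> {..<n}"
    then have fin: "finite K" using finite_subset by auto
    show "lower n y K = 0"
    \<comment> \<open>One level below the top, no term of \<open>x\<close> is too high for
      \<open>ext_diff_eq_lower\<close>; at all other levels \<open>lower n y\<close> is zero by
      grading.\<close>
    proof (cases "Suc (\<Sum>K) = \<Sum>I \<and> K \<in> ext_sets r n")
      case True
      then have "lower n x K = ext_diff r n x K"
        using I(3) by (intro ext_diff_eq_lower[symmetric] x) auto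
      then show ?thesis using True 0 by (simp add: y_def lower_graded[OF fin])
    next
      case False
      have "lower n x K = 0" if "K \<notin> ext_sets r n"
        using lower_mem_supp_space[OF x] that by (simp add: supp_space_def)
      then show ?thesis using False by (auto simp: y_def lower_graded[OF fin])
    qed
  qed (use I(2) in \<open>auto simp: ext_sets_def\<close>)
  then show False using I(1) by (simp add: y_def)
qed

text \<open>\<open>raise\<close> lifts the element sum by one, so the top component of
  \<open>raise n x\<close> comes from the top component \<open>y\<close> of \<open>x\<close>. The
  leading part of the hypothesis is then \<open>D U y = 0\<close>, while \<open>y\<close> has
  negative weight.\<close>

lemma ext_diff_raise_eq_0D:
  assumes x: "x \<in> supp_space (ext_sets r n)" and wt: "\<And>J. x J \<noteq> 0 \<Longrightarrow> wt n J < 0"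
    and 0: "ext_diff r n (raise n x) = 0"
  shows "x = 0"
proof (rule ccontr)
  assume "x \<noteq> 0"
  then obtain J where J: "x J \<noteq> 0" by (auto simp: fun_eq_iff)
  obtain I where I: "x I \<noteq> 0" "I \<in> ext_sets r n" "\<And>L. x L \<noteq> 0 \<Longrightarrow> \<Sum>L \<le> \<Sum>I"
    using supp_space_Max_sum[OF x J] by blast
  have ux: "raise n x \<in> supp_space (ext_sets r n)" by (rule raise_mem_supp_space[OF x])
  have le: "\<Sum>K \<le> Suc (\<Sum>I)" if nz: "raise n x K \<noteq> 0" for K
  proof -
    have "K \<in> ext_sets r n" using ux nz by (auto simp: supp_space_def)
    then have fin: "finite K" by (rule finite_mem_ext_sets)
    obtain a where a: "a \<notin> K" "Suc a \<in> K" "x (flip a K) \<noteq> 0"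
      using raise_nonzeroE[OF nz] by blast
    have "\<Sum>K = Suc (\<Sum>(flip a K))"
      by (rule sum_flip_up[OF fin a(1,2)])
    then show ?thesis using I(3)[OF a(3)] by simp
  qed
  define y where "y = (\<lambda>J. if \<Sum>J = \<Sum>I then x J else 0)"
  have "y I = 0"
  proof (rule lower_raise_eq_0D[of n])
    fix K assume K: "K \<subseteq> {..<n}" "y K \<noteq> 0"
    then show "wt n K < 0" using wt[of K] by (auto simp: y_def split: if_splits)
  next
    fix K assume K: "K \<subseteq> {..<n}"
    then have fin: "finite K" using finite_subset by auto
    have "lower n (raise n y) K = lower n (\<lambda>J. if \<Sum>J = Suc (\<Sum>I) then raise n x J else 0) K"
      unfolding lower_def y_def
      by (intro sum.cong refl if_cong raise_graded finite_flip fin)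
    also have "\<dots> = (if \<Sum>K = \<Sum>I then lower n (raise n x) K else 0)"
      by (simp add: lower_graded[OF fin])
    also have "\<dots> = 0"
    proof (cases "\<Sum>K = \<Sum>I \<and> K \<in> ext_sets r n")
      case True
      then have "lower n (raise n x) K = ext_diff r n (raise n x) K"
        using le by (intro ext_diff_eq_lower[symmetric] ux) auto
      then show ?thesis using 0 by simp
    next
      case False
      have "lower n (raise n x) K = 0" if "K \<notin> ext_sets r n"
        using lower_mem_supp_space[OF ux] that by (simp add: supp_space_def)
      then show ?thesis using False by auto
    qed
    finally show "lower n (raise n y) K = 0" .
  qed (use I(2) in \<open>auto simp: ext_sets_def\<close>)
  then show False using I(1) by (simp add: y_def)
qed

lemma linear_ext_diff:
  "Vector_Spaces.linear (\<lambda>c x i. c * x i) (\<lambda>c x i. c * x i) (ext_diff r n)"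
  by unfold_locales
    (simp_all add: fun_eq_iff ext_diff_def algebra_simps sum.distrib sum_distrib_left)

lemma dim_kernel_ext_diff:
  "fun_space.dim {x \<in> supp_space (ext_sets r n). ext_diff r n x = 0} =
     card {I \<in> ext_sets r n. wt n I \<in> {0, 1}}"
proof -
  \<comment> \<open>The kernel has weights at most 0, but the bound 1 is needed so that
    \<open>raise\<close> maps weight \<open>-1\<close> into \<open>?X\<close>. The operator maps
    \<open>?X\<close> to \<open>?Y\<close> because it lowers weights by at least 2.\<close>
  let ?X = "{I \<in> ext_sets r n. wt n I \<le> 1}" and ?Y = "{I \<in> ext_sets r n. wt n I \<le> - 1}"
  have sub: "supp_space ?X \<subseteq> supp_space (ext_sets r n)" "supp_space ?Y \<subseteq> supp_space (ext_sets r n)"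
    by (auto simp: supp_space_def)
  have kernel: "{x \<in> supp_space (ext_sets r n). ext_diff r n x = 0} = {x \<in> supp_space ?X. ext_diff r n x = 0}"
  proof (intro Collect_cong iffI)
    fix x assume x: "x \<in> supp_space (ext_sets r n) \<and> ext_diff r n x = 0"
    have "x J = 0" if "J \<notin> ?X" for J
    proof (rule ccontr)
      assume nz: "x J \<noteq> 0"
      then have "J \<in> ext_sets r n" using x by (auto simp: supp_space_def)
      moreover have "wt n J \<le> 0" using ext_diff_eq_0D[of x r n J] x nz by simp
      ultimately show False using that by simp
    qed
    then show "x \<in> supp_space ?X \<and> ext_diff r n x = 0" using x by (simp add: supp_space_def)
  next
    fix x assume "x \<in> supp_space ?X \<and> ext_diff r n x = 0"
    then show "x \<in> supp_space (ext_sets r n) \<and> ext_diff r n x = 0" using sub(1) by blast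
  qed
  have fin: "finite ?X" "finite ?Y" by simp_all
  have "fun_space.dim {x \<in> supp_space ?X. ext_diff r n x = 0} + fun_space.dim (supp_space ?Y)
      = fun_space.dim (supp_space ?X)"
  proof (rule fun_space.dim_kernel_add[where u = "raise n"])
    show "Vector_Spaces.linear (\<lambda>c x i. c * x i) (\<lambda>c x i. c * x i) (ext_diff r n)"
      by (rule linear_ext_diff)
    show "Vector_Spaces.linear (\<lambda>c x i. c * x i) (\<lambda>c x i. c * x i) (raise n)"
    proof unfold_locales
      fix x y show "raise n (x + y) = raise n x + raise n y"
        unfolding fun_eq_iff raise_def plus_fun_apply sum.distrib[symmetric]
        by (intro allI sum.cong refl) (simp add: distrib_left)
    next
      fix c x show "raise n (\<lambda>i. c * x i) = (\<lambda>i. c * raise n x i)"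
        unfolding fun_eq_iff raise_def sum_distrib_left
        by (intro allI sum.cong refl) simp
    qed
    show "supp_space ?X \<subseteq> fun_space.span (unit_fun ` ?X)"
      by (rule supp_space_subset_span[OF fin(1)])
    show "ext_diff r n ` supp_space ?X \<subseteq> supp_space ?Y"
    proof (clarsimp simp: supp_space_def[of ?Y])
      fix x K assume x: "x \<in> supp_space ?X" and K: "K \<in> ext_sets r n \<longrightarrow> \<not> wt n K \<le> - 1"
      have "x J * (of_int (shift_coeff n (sorted_list_of_set J) K) - of_bool (J = K)) = 0"
        if J: "J \<in> ext_sets r n" for J
      proof (cases "x J = 0")
        case False
        then have "wt n J \<le> 1" using x by (auto simp: supp_space_def)
        \<comment> \<open>The weight of \<open>J\<close> exceeds that of \<open>K\<close> by at most
          1; as the difference is even, it is not positive.\<close>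
        then have "K \<notin> ext_sets r n \<or> \<Sum>J \<le> \<Sum>K"
          using K J by (auto simp: wt_ext_sets simp del: of_nat_sum)
        then show ?thesis using shift_coeff_sorted_list_of_set[OF J] by simp
      qed simp
      then show "ext_diff r n x K = 0"
        using x sub(1) by (subst ext_diff_altdef) (auto intro!: sum.neutral)
    qed
    show "raise n ` supp_space ?Y \<subseteq> supp_space ?X"
    proof (clarsimp simp: supp_space_def[of ?X])
      fix x K assume x: "x \<in> supp_space ?Y" and K: "K \<in> ext_sets r n \<longrightarrow> \<not> wt n K \<le> 1"
      show "raise n x K = 0"
      proof (rule ccontr)
        assume nz: "raise n x K \<noteq> 0"
        have KX: "K \<in> ext_sets r n" 
          using raise_mem_supp_space[of x r n] x sub(2) nz by (auto simp: supp_space_def)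
        obtain a where a: "a \<notin> K" "Suc a \<in> K" "x (flip a K) \<noteq> 0"
          using raise_nonzeroE[OF nz] by blast
        have "\<Sum>K = Suc (\<Sum>(flip a K))"
          by (rule sum_flip_up[OF finite_mem_ext_sets[OF KX] a(1,2)])
        moreover have "flip a K \<in> ext_sets r n" "wt n (flip a K) \<le> - 1"
          using x a(3) by (auto simp: supp_space_def)
        ultimately show False using K KX by (simp add: wt_ext_sets del: of_nat_sum)
      qed
    qed
    fix x assume x: "x \<in> supp_space ?Y" and 0: "ext_diff r n (raise n x) = 0"
    show "x = 0"
    proof (rule ext_diff_raise_eq_0D[OF _ _ 0])
      show "x \<in> supp_space (ext_sets r n)" using x sub(2) by blast
      fix J assume "x J \<noteq> 0"
      then have "J \<in> ?Y" using x unfolding supp_space_def by blast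
      then show "wt n J < 0" by simp
    qed
  qed (use fin subspace_supp_space in auto)
  then have "fun_space.dim {x \<in> supp_space ?X. ext_diff r n x = 0} = card ?X - card ?Y"
    unfolding dim_supp_space[OF fin(1)] dim_supp_space[OF fin(2)] by simp
  also have "\<dots> = card (?X - ?Y)" using fin by (intro card_Diff_subset[symmetric]) auto
  also have "?X - ?Y = {I \<in> ext_sets r n. wt n I \<in> {0, 1}}" by auto
  finally show ?thesis unfolding kernel .
qed

section \<open>Ranks of groups of integer-valued functions\<close>

definition rat_fun :: "('a \<Rightarrow> int) \<Rightarrow> 'a \<Rightarrow> rat" where
  "rat_fun x i = of_int (x i)"

lemma inj_rat_fun: "inj rat_fun"
  by (rule injI) (simp add: fun_eq_iff rat_fun_def)

lemma common_denominator:
  fixes f :: "'a \<Rightarrow> rat"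
  assumes "finite A"
  obtains d :: int and m :: "'a \<Rightarrow> int"
  where "d > 0" "\<And>i. i \<in> A \<Longrightarrow> of_int (m i) = of_int d * f i"
proof -
  have "\<exists>d::int. d > 0 \<and> (\<forall>i\<in>A. \<exists>m::int. of_int m = of_int d * f i)"
    using assms
  proof (induction A rule: finite_induct)
    case empty
    show ?case by (intro exI[of _ 1]) simp
  next
    case (insert a A)
    then obtain d where d: "d > 0" "\<forall>i\<in>A. \<exists>m::int. of_int m = of_int d * f i" by blast
    obtain p q where "quotient_of (f a) = (p, q)" by (cases "quotient_of (f a)")
    then have q: "q > 0" "f a = of_int p / of_int q"
      by (rule quotient_of_denom_pos, rule quotient_of_div)
    have "\<exists>m::int. of_int m = of_int (d * q) * f i" if "i \<in> insert a A" for i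
    proof (cases "i = a")
      case True
      have "of_int (d * p) = of_int (d * q) * f i" unfolding True q(2) using q(1) by simp
      then show ?thesis by (rule exI)
    next
      case False
      with that have "i \<in> A" by simp
      with d(2) obtain m :: int where m: "of_int m = of_int d * f i" by blast
      have "of_int (q * m) = of_int (d * q) * f i" unfolding of_int_mult m by simp
      then show ?thesis by (rule exI)
    qed
    then show ?case using d(1) q(1) by (intro exI[of _ "d * q"]) simp
  qed
  then obtain d :: int where "d > 0" "\<forall>i\<in>A. \<exists>m::int. of_int m = of_int d * f i" by blast
  then obtain m :: "'a \<Rightarrow> int" where "\<forall>i\<in>A. of_int (m i) = of_int d * f i"
    using bchoice[of A "\<lambda>i m. of_int m = of_int d * f i"] by blast
  with \<open>d > 0\<close> show ?thesis using that by blast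
qed

text \<open>Multiplying a rational relation by a common denominator of its coefficients gives an
  integral one.\<close>

lemma independent_rat_fun:
  fixes B :: "(nat set \<Rightarrow> int) set"
  assumes B: "finite B" "zmod.independent B"
  shows "fun_space.independent (rat_fun ` B)"
  unfolding fun_space.dependent_finite[OF finite_imageI[OF B(1)]]
proof (intro notI, elim exE conjE bexE)
  fix u v
  assume v: "v \<in> rat_fun ` B" "u v \<noteq> 0" and 0: "(\<Sum>v\<in>rat_fun ` B. (\<lambda>i. u v * v i)) = 0"
  obtain d m where dm: "d > 0" "\<And>b. b \<in> B \<Longrightarrow> of_int (m b) = of_int d * u (rat_fun b)"
    using common_denominator[OF B(1), of "\<lambda>b. u (rat_fun b)"] by blast
  have "(\<Sum>b\<in>B. (\<lambda>i. m b * b i)) = 0"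
  proof
    fix i
    have "(of_int ((\<Sum>b\<in>B. (\<lambda>i. m b * b i)) i) :: rat) = (\<Sum>b\<in>B. of_int d * (u (rat_fun b) * rat_fun b i))"
      unfolding sum_fun_apply of_int_sum by (intro sum.cong refl) (simp add: dm(2) rat_fun_def)
    also have "\<dots> = of_int d * (\<Sum>v\<in>rat_fun ` B. (\<lambda>i. u v * v i)) i"
      unfolding sum_fun_apply sum_distrib_left[symmetric]
      by (subst sum.reindex) (auto intro: inj_on_subset[OF inj_rat_fun])
    also have "\<dots> = 0" unfolding 0 by simp
    finally show "(\<Sum>b\<in>B. (\<lambda>i. m b * b i)) i = 0 i" by simp
  qed
  then have "m b = 0" if "b \<in> B" for b
    using zmod.independentD[OF B(2) B(1) subset_refl] that by blast
  moreover obtain b where "b \<in> B" "v = rat_fun b" using v(1) by blast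
  ultimately show False using dm(1) dm(2)[of b] v(2) by simp
qed

text \<open>Rescaling by nonzero factors preserves independence. A coincidence
  \<open>b e = b e'\<close> would make two distinct members of \<open>E\<close>
  proportional.\<close>

lemma integral_basis:
  fixes E :: "(nat set \<Rightarrow> rat) set"
  assumes E: "finite E" "fun_space.independent E" and d: "\<And>e. e \<in> E \<Longrightarrow> d e > 0"
    and b: "\<And>e. e \<in> E \<Longrightarrow> rat_fun (b e) = (\<lambda>i. of_int (d e) * e i)"
  shows "zmod.independent (b ` E)" "inj_on b E"
proof -
  show inj: "inj_on b E"
  proof (rule inj_onI, rule ccontr)
    fix e e' assume e: "e \<in> E" "e' \<in> E" "b e = b e'" "e \<noteq> e'"
    define u where "u v = (if v = e then of_int (d e) else - of_int (d e') :: rat)" for v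
    have "(\<Sum>v\<in>{e, e'}. (\<lambda>i. u v * v i)) = (\<lambda>i. of_int (d e) * e i) - (\<lambda>i. of_int (d e') * e' i)"
      using e(4) by (auto simp: u_def fun_eq_iff)
    also have "\<dots> = rat_fun (b e) - rat_fun (b e')" using b e(1,2) by simp
    also have "\<dots> = 0" using e(3) by simp
    finally have "u e = 0"
      using fun_space.independentD[OF E(2), of "{e, e'}" u e] e(1,2) by simp
    then show False using d[OF e(1)] by (simp add: u_def)
  qed
  show "zmod.independent (b ` E)"
    unfolding zmod.dependent_finite[OF finite_imageI[OF E(1)]]
  proof (intro notI, elim exE conjE bexE)
    fix u v
    assume v: "v \<in> b ` E" "u v \<noteq> 0" and 0: "(\<Sum>v\<in>b ` E. (\<lambda>i. u v * v i)) = 0"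
    have "(\<Sum>e\<in>E. (\<lambda>i. (of_int (u (b e)) * of_int (d e)) * e i)) = (0 :: nat set \<Rightarrow> rat)"
    proof
      fix i
      have "(\<Sum>e\<in>E. (\<lambda>i. (of_int (u (b e)) * of_int (d e)) * e i)) i = (\<Sum>e\<in>E. of_int (u (b e) * b e i) :: rat)"
        unfolding sum_fun_apply
      proof (intro sum.cong refl)
        fix e assume "e \<in> E"
        then have "of_int (b e i) = of_int (d e) * e i"
          using fun_cong[OF b, of e i] by (simp add: rat_fun_def)
        then show "of_int (u (b e)) * of_int (d e) * e i = of_int (u (b e) * b e i)" by simp
      qed
      also have "\<dots> = of_int ((\<Sum>v\<in>b ` E. (\<lambda>i. u v * v i)) i)"
        unfolding sum_fun_apply sum.reindex[OF inj] by simp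
      also have "\<dots> = 0" unfolding 0 by simp
      finally show "(\<Sum>e\<in>E. (\<lambda>i. (of_int (u (b e)) * of_int (d e)) * e i)) i = 0 i" by simp
    qed
    then have z: "of_int (u (b e)) * of_int (d e) = (0::rat)" if "e \<in> E" for e
      using fun_space.independentD[OF E(2) E(1) subset_refl _ that, of "\<lambda>e. of_int (u (b e)) * of_int (d e)"] by blast
    obtain e where "e \<in> E" "v = b e" using v(1) by blast
    then show False using z[of e] d[of e] v(2) by simp
  qed
qed

text \<open>Integrally independent elements stay independent over the rationals, which bounds the
  rank. The bound is attained by clearing denominators in a basis of \<open>V\<close>, possible
  because the supports lie in the finite set \<open>X\<close>.\<close>

lemma group_rank_eq_dim:
  assumes V: "fun_space.subspace V" and X: "finite X" "V \<subseteq> supp_space X"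
  shows "group_rank {x. rat_fun x \<in> V} = fun_space.dim V"
proof -
  obtain E where E: "E \<subseteq> V" "fun_space.independent E" "V \<subseteq> fun_space.span E" "card E = fun_space.dim V"
    by (rule fun_space.basis_exists)
  have "E \<subseteq> fun_space.span (unit_fun ` X)" using E(1) X supp_space_subset_span by blast
  then have finE: "finite E"
    using fun_space.independent_span_bound[OF finite_imageI[OF X(1)] E(2)] by blast
  have upper: "card B \<le> fun_space.dim V"
    if B: "finite B" "B \<subseteq> {x. rat_fun x \<in> V}" "zmod.independent B" for B
  proof -
    have "rat_fun ` B \<subseteq> fun_space.span E" using B(2) E(3) by blast
    then have "card (rat_fun ` B) \<le> card E"
      using fun_space.independent_span_bound[OF finE independent_rat_fun[OF B(1,3)]] by blast
    moreover have "card (rat_fun ` B) = card B"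
      by (rule card_image[OF inj_on_subset[OF inj_rat_fun]]) simp
    ultimately show ?thesis using E(4) by simp
  qed
  have "\<exists>db. fst db > 0 \<and> rat_fun (snd db) = (\<lambda>i. of_int (fst db) * e i)" if "e \<in> E" for e
  proof -
    obtain d m where dm: "d > 0" "\<And>i. i \<in> X \<Longrightarrow> of_int (m i) = of_int d * e i"
      using common_denominator[OF X(1), of e] by blast
    have "e i = 0" if "i \<notin> X" for i using \<open>e \<in> E\<close> E(1) X(2) that by (auto simp: supp_space_def)
    then have "rat_fun (\<lambda>i. if i \<in> X then m i else 0) = (\<lambda>i. of_int d * e i)"
      using dm(2) by (auto simp: rat_fun_def)
    then show ?thesis using dm(1) by (intro exI[of _ "(d, \<lambda>i. if i \<in> X then m i else 0)"]) simp
  qed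
  then obtain db where "\<forall>e\<in>E. fst (db e) > 0 \<and> rat_fun (snd (db e)) = (\<lambda>i. of_int (fst (db e)) * e i)"
    using bchoice[of E "\<lambda>e db. fst db > 0 \<and> rat_fun (snd db) = (\<lambda>i. of_int (fst db) * e i)"] by blast
  then have db: "\<And>e. e \<in> E \<Longrightarrow> fst (db e) > 0"
      "\<And>e. e \<in> E \<Longrightarrow> rat_fun (snd (db e)) = (\<lambda>i. of_int (fst (db e)) * e i)"
    by blast+
  have B: "zmod.independent ((\<lambda>e. snd (db e)) ` E)" "inj_on (\<lambda>e. snd (db e)) E"
    by (rule integral_basis[OF finE E(2), of "\<lambda>e. fst (db e)" "\<lambda>e. snd (db e)"], erule db, erule db)+
  have "rat_fun (snd (db e)) \<in> V" if "e \<in> E" for e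
    unfolding db(2)[OF that] using that E(1) by (intro fun_space.subspace_scale[OF V]) blast
  then have sub: "(\<lambda>e. snd (db e)) ` E \<subseteq> {x. rat_fun x \<in> V}" by blast
  have card: "card ((\<lambda>e. snd (db e)) ` E) = fun_space.dim V"
    unfolding card_image[OF B(2)] by (rule E(4))
  show ?thesis
    unfolding group_rank_def
  proof (rule Max_eqI)
    show "finite {card B |B. finite B \<and> B \<subseteq> {x. rat_fun x \<in> V} \<and> zmod.independent B}"
      by (rule finite_subset[of _ "{..fun_space.dim V}"]) (use upper in auto)
    show "k \<le> fun_space.dim V"
      if "k \<in> {card B |B. finite B \<and> B \<subseteq> {x. rat_fun x \<in> V} \<and> zmod.independent B}" for k
      using that upper by blast
    show "fun_space.dim V \<in> {card B |B. finite B \<and> B \<subseteq> {x. rat_fun x \<in> V} \<and> zmod.independent B}"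
      using card[symmetric] sub B(1) finite_imageI[OF finE] by blast
  qed
qed

text \<open>Presents the integral kernel as the group of integral points of the rational kernel, the
  form that \<open>group_rank_eq_dim\<close> handles.\<close>

lemma ext_power_kernel:
  "{x \<in> ext_power r n. ext_power_map r (jordan_block n 1) x - x = 0} =
   {x. rat_fun x \<in> {x \<in> supp_space (ext_sets r n). ext_diff r n x = 0}}"
proof -
  have supp: "x \<in> ext_power r n \<longleftrightarrow> rat_fun x \<in> supp_space (ext_sets r n)" for x
    by (auto simp: ext_power_def supp_space_def ext_sets_def rat_fun_def)
  have "ext_diff r n (rat_fun x) = rat_fun (ext_power_map r (jordan_block n 1) x - x)" for x
    by (simp add: fun_eq_iff ext_diff_def rat_fun_def ext_power_map_def ext_sets_def shift_coeff_def)
  moreover have "rat_fun y = 0 \<longleftrightarrow> y = 0" for y :: "nat set \<Rightarrow> int"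
    by (simp add: fun_eq_iff rat_fun_def)
  ultimately show ?thesis unfolding mem_Collect_eq supp by simp
qed

section \<open>Counting subsets\<close>

lemma card_subsets_bij:
  assumes f: "bij_betw f A B" and PQ: "\<And>I. I \<subseteq> A \<Longrightarrow> P I \<longleftrightarrow> Q (f ` I)"
  shows "card {I. I \<subseteq> A \<and> P I} = card {J. J \<subseteq> B \<and> Q J}"
proof -
  have "bij_betw ((`) f) (Pow A) (Pow B)" by (rule bij_betw_Pow[OF f])
  then have inj: "inj_on ((`) f) (Pow A)" and im: "((`) f) ` Pow A = Pow B"
    by (auto simp: bij_betw_def)
  have "((`) f) ` {I. I \<subseteq> A \<and> P I} = {J. J \<subseteq> B \<and> Q J}" (is "?l = ?r")
  proof (intro equalityI subsetI)
    fix J assume "J \<in> ?l"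
    then obtain I where "I \<subseteq> A" "P I" "J = f ` I" by blast
    then show "J \<in> ?r" using PQ[of I] im by blast
  next
    fix J assume J: "J \<in> ?r"
    then have "J \<in> ((`) f) ` Pow A" unfolding im by blast
    then obtain I where "I \<subseteq> A" "J = f ` I" by blast
    then show "J \<in> ?l" using PQ[of I] J by blast
  qed
  moreover have "inj_on ((`) f) {I. I \<subseteq> A \<and> P I}"
    by (rule inj_on_subset[OF inj]) auto
  ultimately show ?thesis by (metis card_image)
qed

text \<open>A function corresponds to the set where it equals 1. Extensionality in
  \<open>\<rightarrow>\<^sub>E\<close> fixes its values off \<open>S\<close>, so the restricted
  indicator is a true inverse.\<close>

lemma card_01_functions:
  fixes g :: "'a \<Rightarrow> int"
  assumes S: "finite S"
  shows "card {\<epsilon> \<in> S \<rightarrow>\<^sub>E {0, 1::int}. P (\<Sum>k\<in>S. g k * \<epsilon> k)} = card {A. A \<subseteq> S \<and> P (\<Sum>k\<in>A. g k)}"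
proof (rule bij_betw_same_card)
  let ?ind = "\<lambda>A. \<lambda>k\<in>S. of_bool (k \<in> A) :: int"
  let ?ones = "\<lambda>\<epsilon>. {k\<in>S. \<epsilon> k = (1::int)}"
  have sum: "(\<Sum>k\<in>S. g k * \<epsilon> k) = (\<Sum>k\<in>?ones \<epsilon>. g k)" if "\<epsilon> \<in> S \<rightarrow>\<^sub>E {0, 1}" for \<epsilon>
  proof -
    have "g k * \<epsilon> k = (if \<epsilon> k = 1 then g k else 0)" if "k \<in> S" for k
      using \<open>\<epsilon> \<in> S \<rightarrow>\<^sub>E {0, 1}\<close> that by (auto dest: PiE_mem)
    then have "(\<Sum>k\<in>S. g k * \<epsilon> k) = (\<Sum>k\<in>S. if \<epsilon> k = 1 then g k else 0)"
      by (rule sum.cong[OF refl])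
    also have "\<dots> = (\<Sum>k\<in>?ones \<epsilon>. g k)" by (rule sum.inter_filter[OF S, symmetric])
    finally show ?thesis .
  qed
  have ind: "?ind A \<in> S \<rightarrow>\<^sub>E {0, 1}" for A by auto
  have ones: "?ones (?ind A) = A" if "A \<subseteq> S" for A using that by auto
  have ind_ones: "?ind (?ones \<epsilon>) = \<epsilon>" if "\<epsilon> \<in> S \<rightarrow>\<^sub>E {0, 1}" for \<epsilon>
  proof
    fix k show "?ind (?ones \<epsilon>) k = \<epsilon> k"
      using PiE_mem[OF that, of k] PiE_arb[OF that, of k] by (cases "k \<in> S") auto
  qed
  show "bij_betw ?ones {\<epsilon> \<in> S \<rightarrow>\<^sub>E {0, 1}. P (\<Sum>k\<in>S. g k * \<epsilon> k)} {A. A \<subseteq> S \<and> P (\<Sum>k\<in>A. g k)}"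
  proof (rule bij_betw_byWitness[where f' = ?ind])
    show "?ones ` {\<epsilon> \<in> S \<rightarrow>\<^sub>E {0, 1}. P (\<Sum>k\<in>S. g k * \<epsilon> k)} \<subseteq> {A. A \<subseteq> S \<and> P (\<Sum>k\<in>A. g k)}"
    proof clarify
      fix \<epsilon> assume e: "\<epsilon> \<in> S \<rightarrow>\<^sub>E {0, 1}" "P (\<Sum>k\<in>S. g k * \<epsilon> k)"
      then show "?ones \<epsilon> \<subseteq> S \<and> P (\<Sum>k\<in>?ones \<epsilon>. g k)" unfolding sum[OF e(1)] by blast
    qed
    show "?ind ` {A. A \<subseteq> S \<and> P (\<Sum>k\<in>A. g k)} \<subseteq> {\<epsilon> \<in> S \<rightarrow>\<^sub>E {0, 1}. P (\<Sum>k\<in>S. g k * \<epsilon> k)}"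
    proof clarify
      fix A assume A: "A \<subseteq> S" "P (\<Sum>k\<in>A. g k)"
      then show "?ind A \<in> S \<rightarrow>\<^sub>E {0, 1} \<and> P (\<Sum>k\<in>S. g k * ?ind A k)"
        using ind[of A] unfolding sum[OF ind] ones[OF A(1)] by blast
    qed
  qed (use ones ind_ones in blast)+
qed

section \<open>The rank as a number of subsets of weight 0 or 1\<close>

lemma group_rank_kernel:
  "group_rank {x \<in> ext_power r n. ext_power_map r (jordan_block n 1) x - x = 0} =
    card {I \<in> ext_sets r n. wt n I \<in> {0, 1}}"
proof -
  interpret ext_diff: Vector_Spaces.linear "\<lambda>(c::rat) x i. c * x i" "\<lambda>(c::rat) x i. c * x i" "ext_diff r n"
    by (rule linear_ext_diff)
  have "fun_space.subspace {x \<in> supp_space (ext_sets r n). ext_diff r n x = 0}"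
    using fun_space.subspace_inter[OF subspace_supp_space ext_diff.subspace_kernel]
    by (simp add: Int_def)
  then have "group_rank {x. rat_fun x \<in> {x \<in> supp_space (ext_sets r n). ext_diff r n x = 0}} =
      fun_space.dim {x \<in> supp_space (ext_sets r n). ext_diff r n x = 0}"
    by (rule group_rank_eq_dim[OF _ finite_ext_sets]) blast
  then show ?thesis unfolding ext_power_kernel dim_kernel_ext_diff .
qed

lemma anzai_K_rank_eq_card: "anzai_K_rank n = card {I. I \<subseteq> {..<n} \<and> wt n I \<in> {0, 1}}"
proof -
  have "{I. I \<subseteq> {..<n} \<and> wt n I \<in> {0, 1}} = (\<Union>r\<le>n. {I \<in> ext_sets r n. wt n I \<in> {0, 1}})"
    using card_mono[of "{..<n}"] by (auto simp: ext_sets_def)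
  moreover have "card (\<Union>r\<le>n. {I \<in> ext_sets r n. wt n I \<in> {0, 1}}) = 
      (\<Sum>r\<le>n. card {I \<in> ext_sets r n. wt n I \<in> {0, 1}})"
    by (rule card_UN_disjoint) (auto simp: ext_sets_def)
  ultimately show ?thesis unfolding anzai_K_rank_def group_rank_kernel by simp
qed

section \<open>Reindexing by integers and half-integers\<close>

lemma bij_betw_nat_int: "bij_betw (\<lambda>i. int i + a) {..<m} {a..a + int m - 1}"
  by (rule bij_betw_byWitness[where f' = "\<lambda>k. nat (k - a)"]) auto

lemma bij_betw_half_integers:
  "bij_betw (\<lambda>k. of_int k - 1/2) {- int n + 1..int n}
     {h::rat. (\<exists>m::int. h = of_int m + 1/2) \<and> - of_nat n + 1/2 \<le> h \<and> h \<le> of_nat n - 1/2}"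
  unfolding bij_betw_def
proof
  show "inj_on (\<lambda>k. of_int k - 1/2 :: rat) {- int n + 1..int n}" by (auto intro: inj_onI)
  show "(\<lambda>k. of_int k - 1/2) ` {- int n + 1..int n} =
     {h::rat. (\<exists>m::int. h = of_int m + 1/2) \<and> - of_nat n + 1/2 \<le> h \<and> h \<le> of_nat n - 1/2}" (is "?l = ?r")
  proof (intro equalityI subsetI)
    fix h assume "h \<in> ?l"
    then obtain k where k: "- int n + 1 \<le> k" "k \<le> int n" "h = of_int k - 1/2" by auto
    have "h = of_int (k - 1) + 1/2" using k(3) by simp
    moreover
    have "(of_int (- int n + 1) :: rat) \<le> of_int k" "(of_int k :: rat) \<le> of_int (int n)"
      unfolding of_int_le_iff by (rule k(1), rule k(2))
    then have "- of_nat n + 1/2 \<le> h" "h \<le> of_nat n - 1/2" using k(3) by simp_all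
    ultimately show "h \<in> ?r" by blast
  next
    fix h assume "h \<in> ?r"
    then obtain m :: int where m: "h = of_int m + 1/2" "- of_nat n + 1/2 \<le> h" "h \<le> of_nat n - 1/2" by blast
    then have "(of_int (- int n) :: rat) \<le> of_int m" "(of_int (m + 1) :: rat) \<le> of_int (int n)" by simp_all
    then have "m + 1 \<in> {- int n + 1..int n}" unfolding of_int_le_iff by simp
    moreover have "h = of_int (m + 1) - 1/2" using m(1) by simp
    ultimately show "h \<in> ?l" by (intro image_eqI)
  qed
qed

theorem corollary6p8:
  fixes n :: nat
  shows
    "anzai_K_rank (2 * n + 1) =
       card {\<epsilon> \<in> {- int n..int n} \<rightarrow>\<^sub>E {0, 1::int}. (\<Sum>k\<in>{- int n..int n}. k * \<epsilon> k) = 0}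
     \<and> anzai_K_rank (2 * n + 1) =
       card {A. A \<subseteq> {- int n..int n} \<and> \<Sum>A = 0}
     \<and> anzai_K_rank (2 * n) =
       card {\<epsilon> \<in> {- int n + 1..int n} \<rightarrow>\<^sub>E {0, 1::int}.
              (\<Sum>k\<in>{- int n + 1..int n}. (2 * k - 1) * \<epsilon> k) = 0 \<or>
              (\<Sum>k\<in>{- int n + 1..int n}. (2 * k - 1) * \<epsilon> k) = 1}
     \<and> anzai_K_rank (2 * n) =
       card {A. A \<subseteq> {h::rat. (\<exists>m::int. h = of_int m + 1/2) \<and>
                           - of_nat n + 1/2 \<le> h \<and> h \<le> of_nat n - 1/2} \<and>
                (\<Sum>A = 0 \<or> \<Sum>A = 1/2)}"
proof -
  let ?S = "{- int n..int n}" and ?T = "{- int n + 1..int n}"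
  let ?H = "{h::rat. (\<exists>m::int. h = of_int m + 1/2) \<and> - of_nat n + 1/2 \<le> h \<and> h \<le> of_nat n - 1/2}"
  have odd: "anzai_K_rank (2 * n + 1) = card {A. A \<subseteq> ?S \<and> \<Sum>A = 0}"
    unfolding anzai_K_rank_eq_card
  proof (rule card_subsets_bij)
    show "bij_betw (\<lambda>i. int i + - int n) {..<2 * n + 1} ?S"
      using bij_betw_nat_int[of "- int n" "2 * n + 1"] by simp
    fix I :: "nat set"
    \<comment> \<open>In odd dimension the weight is twice the sum of the shifted indices
      \<open>i - n\<close>, hence even: the value 1 cannot occur.\<close>
    have "wt (2 * n + 1) I = 2 * (\<Sum>i\<in>I. int i + - int n)"
      unfolding wt_def sum_distrib_left by (intro sum.cong refl) simp
    also have "(\<Sum>i\<in>I. int i + - int n) = \<Sum>((\<lambda>i. int i + - int n) ` I)"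
      by (subst sum.reindex) (auto intro: inj_onI)
    finally show "wt (2 * n + 1) I \<in> {0, 1} \<longleftrightarrow> \<Sum>((\<lambda>i. int i + - int n) ` I) = 0"
      by (simp only: insert_iff empty_iff) presburger
  qed
  have even: "anzai_K_rank (2 * n) = card {A. A \<subseteq> ?T \<and> ((\<Sum>k\<in>A. 2 * k - 1) = 0 \<or> (\<Sum>k\<in>A. 2 * k - 1) = 1)}"
    unfolding anzai_K_rank_eq_card
  proof (rule card_subsets_bij)
    show "bij_betw (\<lambda>i. int i + (- int n + 1)) {..<2 * n} ?T"
      using bij_betw_nat_int[of "- int n + 1" "2 * n"] by simp
    fix I :: "nat set"
    \<comment> \<open>In even dimension \<open>k = i - n + 1\<close> turns
      \<open>2 * i + 1 - 2 * n\<close> into \<open>2 * k - 1\<close>.\<close>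
    have "wt (2 * n) I = (\<Sum>k\<in>(\<lambda>i. int i + (- int n + 1)) ` I. 2 * k - 1)"
      unfolding wt_def by (subst sum.reindex) (auto intro: inj_onI sum.cong)
    then show "wt (2 * n) I \<in> {0, 1} \<longleftrightarrow> (\<Sum>k\<in>(\<lambda>i. int i + (- int n + 1)) ` I. 2 * k - 1) = 0 \<or>
        (\<Sum>k\<in>(\<lambda>i. int i + (- int n + 1)) ` I. 2 * k - 1) = 1" by simp
  qed
  \<comment> \<open>The half-integer \<open>k - 1/2\<close> is half of \<open>2 * k - 1\<close>, so
    the sums 0 and 1 become 0 and 1/2.\<close>
  have "card {A. A \<subseteq> ?T \<and> ((\<Sum>k\<in>A. 2 * k - 1) = 0 \<or> (\<Sum>k\<in>A. 2 * k - 1) = 1)} =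
      card {A. A \<subseteq> ?H \<and> (\<Sum>A = 0 \<or> \<Sum>A = 1/2)}"
  proof (rule card_subsets_bij[OF bij_betw_half_integers])
    fix I :: "int set"
    have "\<Sum>((\<lambda>k. of_int k - 1/2) ` I) = (\<Sum>k\<in>I. of_int k - 1/2 :: rat)"
      by (subst sum.reindex) (auto intro: inj_onI)
    also have "2 * \<dots> = of_int (\<Sum>k\<in>I. 2 * k - 1)"
      unfolding sum_distrib_left of_int_sum by (intro sum.cong refl) simp
    finally have *: "2 * \<Sum>((\<lambda>k. of_int k - 1/2 :: rat) ` I) = of_int (\<Sum>k\<in>I. 2 * k - 1)" .
    have "(\<Sum>k\<in>I. 2 * k - 1) = 0 \<longleftrightarrow> (of_int (\<Sum>k\<in>I. 2 * k - 1) :: rat) = 0"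
      "(\<Sum>k\<in>I. 2 * k - 1) = 1 \<longleftrightarrow> (of_int (\<Sum>k\<in>I. 2 * k - 1) :: rat) = 1"
      by (simp_all only: of_int_eq_0_iff of_int_eq_1_iff)
    then show "(\<Sum>k\<in>I. 2 * k - 1) = 0 \<or> (\<Sum>k\<in>I. 2 * k - 1) = 1 \<longleftrightarrow>
        \<Sum>((\<lambda>k. of_int k - 1/2 :: rat) ` I) = 0 \<or> \<Sum>((\<lambda>k. of_int k - 1/2 :: rat) ` I) = 1/2"
      unfolding *[symmetric] by auto
  qed
  then show ?thesis
    using odd even card_01_functions[of ?S "\<lambda>s. s = 0" "\<lambda>k. k"]
      card_01_functions[of ?T "\<lambda>s. s = 0 \<or> s = 1" "\<lambda>k. 2 * k - 1"] by simp
qed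

end
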